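(* Let $\eta=(\eta_1,\dots,\eta_t)$ be a sequence of positive integers with sum $n$, let $\gamma\in\mathbb{Z}^n$ be such that every $R_i$ in the associated sequence $R=(R_1,\dots,R_t)$ is a partition with $\eta_i$ parts (some possibly zero), and let $\lambda$ be a partition with $n$ parts (some possibly zero) such that $|\lambda|=\sum_i|R_i|$ ($\gamma$ itself need not be weakly decreasing). Then $$K_{\lambda;R}(1)=\langle s_\lambda(x),\,s_{R_1}(x)s_{R_2}(x)\cdots s_{R_t}(x)\rangle,$$ where $x=(x_1,\dots,x_n)$ and $\langle\,,\,\rangle$ is the Hall inner product on symmetric polynomials in $x_1,\dots,x_n$ (for which the Schur polynomials are orthonormal).
   Context: Let $\mathrm{Roots}_\eta=\{(i,j):1\le i\le\eta_1+\dots+\eta_r<j\le n\text{ for some }r\}$, $\rho=(n-1,\dots,1,0)$; $S_n$ acts by permuting the variables $x_1,\dots,x_n$. Put $J(f)=\sum_{w\in S_n}(-1)^w\,wf$, $\pi(f)=J(x^\rho)^{-1}J(x^\rho f)$ on Laurent polynomials, and $s_\lambda(x)=\pi(x^\lambda)$ for a dominant weight $\lambda$ ($\lambda_1\ge\dots\ge\lambda_n$). Let $B_\eta(x;q)=\prod_{(i,j)\in\mathrm{Roots}_\eta}(1-q\,x_i/x_j)^{-1}$, $H_{\eta,\gamma}(x;q)=\pi(x^\gamma B_\eta(x;q))$ (formal power series in $q$ with Laurent polynomial coefficients), and define $K_{\lambda,\gamma,\eta}(q)$ by $H_{\eta,\gamma}(x;q)=\sum_\lambda K_{\lambda,\gamma,\eta}(q)s_\lambda(x)$,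 $\lambda$ running over dominant weights; each $K_{\lambda,\gamma,\eta}(q)$ is a polynomial with integer coefficients. $R_1$ is the sequence of the first $\eta_1$ entries of $\gamma$, $R_2$ the next $\eta_2$ entries, etc.; when all $R_i$ are partitions, $K_{\lambda;R}(q):=K_{\lambda,\gamma,\eta}(q)$. *)

theory Defs
  imports
    "HOL-Library.Poly_Mapping"
    "HOL-Combinatorics.Permutations"
    "HOL-Computational_Algebra.Polynomial"
    "HOL-Computational_Algebra.Formal_Power_Series"
begin

text \<open>
  Integer Laurent polynomials form the group ring of finitely supported exponent vectors.
  The variables are numbered from 0, so the usual \<open>x\<^sub>1, \<dots>, x\<^sub>n\<close> are the variables \<open>0, \<dots>, n - 1\<close>.
  Weights are integer lists; \<^const>\<open>Poly_Mapping.nth\<close> pads them with zeros.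
\<close>

type_synonym laurent = "(nat \<Rightarrow>\<^sub>0 int) \<Rightarrow>\<^sub>0 int"

definition monomial :: "(nat \<Rightarrow>\<^sub>0 int) \<Rightarrow> laurent" where
  "monomial a = Poly_Mapping.single a 1"

definition xpow :: "int list \<Rightarrow> laurent" where
  "xpow \<gamma> = monomial (Poly_Mapping.nth \<gamma>)"

text \<open>The ring automorphism sending the variable \<open>x\<^sub>i\<close> to \<open>x\<^bsub>w i\<^esub>\<close>, for bijective \<open>w\<close>.\<close>

definition permute_vars :: "(nat \<Rightarrow> nat) \<Rightarrow> laurent \<Rightarrow> laurent" where
  "permute_vars w f = Poly_Mapping.map_key (Poly_Mapping.map_key w) f"

lemma permute_vars_variable:
  assumes "bij w"
  shows "permute_vars w (monomial (Poly_Mapping.single i c)) =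
         monomial (Poly_Mapping.single (w i) c)"
proof -
  have inj: "inj w" and surj: "surj w"
    using assms by (auto simp: bij_def)
  have inj': "inj (Poly_Mapping.map_key w :: (nat \<Rightarrow>\<^sub>0 int) \<Rightarrow> _)"
  proof (rule injI)
    fix a b :: "nat \<Rightarrow>\<^sub>0 int"
    assume eq: "Poly_Mapping.map_key w a = Poly_Mapping.map_key w b"
    have "Poly_Mapping.lookup a k = Poly_Mapping.lookup b k" for k
    proof -
      obtain j where "k = w j" using surj by (meson surjD)
      then show ?thesis
        using arg_cong[OF eq, of "\<lambda>p. Poly_Mapping.lookup p j"]
        by (simp add: map_key.rep_eq[OF inj])
    qed
    then show "a = b" by (rule poly_mapping_eqI)
  qed
  have "Poly_Mapping.map_key w (Poly_Mapping.single (w i) c) = Poly_Mapping.single i c"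
    by (rule map_key_single[OF inj])
  then show ?thesis
    unfolding permute_vars_def monomial_def
    using map_key_single[OF inj', of "Poly_Mapping.single (w i) c" 1] by simp
qed

definition antisymmetrize :: "nat \<Rightarrow> laurent \<Rightarrow> laurent" where
  "antisymmetrize n f = (\<Sum>w | w permutes {..<n}. of_int (sign w) * permute_vars w f)"

definition rho :: "nat \<Rightarrow> int list" where
  "rho n = map int (rev [0..<n])"

text \<open>
  \<open>\<pi>(f) = J(x\<^sup>\<rho>)\<^sup>-\<^sup>1 J(x\<^sup>\<rho> f)\<close>: the quotient, which is again a Laurent polynomial,
  is unique because \<^typ>\<open>laurent\<close> is an integral domain.
\<close>

definition weyl_pi :: "nat \<Rightarrow> laurent \<Rightarrow> laurent" where
  "weyl_pi n f =
    (THE g. antisymmetrize n (xpow (rho n)) * g = antisymmetrize n (xpow (rho n) * f))"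

text \<open>
  For a list shorter than \<open>n\<close> this is the Schur polynomial in \<open>n\<close> variables
  of the list padded with zeros.
\<close>

definition schur :: "nat \<Rightarrow> int list \<Rightarrow> laurent" where
  "schur n \<mu> = weyl_pi n (xpow \<mu>)"

definition dominant_weights :: "nat \<Rightarrow> int list set" where
  "dominant_weights n = {\<mu>. length \<mu> = n \<and> sorted_wrt (\<ge>) \<mu>}"

definition is_partition :: "int list \<Rightarrow> bool" where
  "is_partition \<mu> \<longleftrightarrow> sorted_wrt (\<ge>) \<mu> \<and> (\<forall>a\<in>set \<mu>. 0 \<le> a)"

text \<open>
  The coefficients of a symmetric Laurent polynomial in \<open>n\<close> variables with respect to the
  \<open>\<int>\<close>-basis of all \<open>s\<^sub>\<mu>\<close> with \<open>\<mu>\<close> dominant.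
\<close>

definition schur_expansion :: "nat \<Rightarrow> laurent \<Rightarrow> int list \<Rightarrow>\<^sub>0 int" where
  "schur_expansion n f =
    (THE c. Poly_Mapping.keys c \<subseteq> dominant_weights n \<and>
            f = (\<Sum>\<mu>\<in>Poly_Mapping.keys c. of_int (Poly_Mapping.lookup c \<mu>) * schur n \<mu>))"

text \<open>
  The bilinear form for which the \<open>s\<^sub>\<mu>\<close> are orthonormal. On symmetric polynomials
  only partitions \<open>\<mu>\<close> occur in the expansions, and it is the Hall inner product.
\<close>

definition hall_inner :: "nat \<Rightarrow> laurent \<Rightarrow> laurent \<Rightarrow> int" where
  "hall_inner n f g =
    (\<Sum>\<mu>\<in>Poly_Mapping.keys (schur_expansion n f).
       Poly_Mapping.lookup (schur_expansion n f) \<mu> * Poly_Mapping.lookup (schur_expansion n g) \<mu>)"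

text \<open>Pairs are 0-based: \<open>(i, j)\<close> stands for the root usually written \<open>(i + 1, j + 1)\<close>.\<close>

definition Roots :: "nat list \<Rightarrow> (nat \<times> nat) set" where
  "Roots \<eta> = {(i, j). \<exists>r\<in>{1..length \<eta>}.
     i < sum_list (take r \<eta>) \<and> sum_list (take r \<eta>) \<le> j \<and> j < sum_list \<eta>}"

text \<open>
  \<^const>\<open>inverse\<close> on power series needs an \<^const>\<open>inverse\<close> on the coefficients, so the inverse of
  \<open>1 - q x\<^sub>i/x\<^sub>j\<close>, whose constant coefficient is 1, is taken by \<^const>\<open>fps_left_inverse\<close>.
\<close>

definition root_factor :: "nat \<times> nat \<Rightarrow> laurent fps" where
  "root_factor = (\<lambda>(i, j). 1 - fps_X *
     fps_const (monomial (Poly_Mapping.single i 1 - Poly_Mapping.single j 1)))"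

definition B_series :: "nat list \<Rightarrow> laurent fps" where
  "B_series \<eta> = (\<Prod>\<alpha>\<in>Roots \<eta>. fps_left_inverse (root_factor \<alpha>) 1)"

lemma finite_Roots: "finite (Roots \<eta>)"
proof (rule finite_subset)
  show "Roots \<eta> \<subseteq> {..<sum_list \<eta>} \<times> {..<sum_list \<eta>}"
    by (auto simp: Roots_def)
qed simp

lemma B_series_inverse: "B_series \<eta> * (\<Prod>\<alpha>\<in>Roots \<eta>. root_factor \<alpha>) = 1"
proof -
  have "fps_left_inverse (root_factor \<alpha>) 1 * root_factor \<alpha> = 1" for \<alpha>
    by (rule fps_left_inverse) (simp add: root_factor_def split: prod.split)
  then show ?thesis
    by (simp add: B_series_def flip: prod.distrib)
qed

definition H_series :: "nat list \<Rightarrow> int list \<Rightarrow> laurent fps" where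
  "H_series \<eta> \<gamma> =
    Abs_fps (\<lambda>k. weyl_pi (sum_list \<eta>) (fps_nth (fps_const (xpow \<gamma>) * B_series \<eta>) k))"

text \<open>
  The expansion \<open>H = (\<Sum>\<mu>. K\<^sub>\<mu>(q) s\<^sub>\<mu>)\<close> may involve infinitely many \<open>\<mu>\<close>, but only finitely many
  for each power of \<open>q\<close>; so it is read off coefficientwise in \<open>q\<close>.
\<close>

definition K_poly :: "nat list \<Rightarrow> int list \<Rightarrow> int list \<Rightarrow> int poly" where
  "K_poly \<eta> \<gamma> \<mu> =
    (THE p. \<forall>k. poly.coeff p k =
       Poly_Mapping.lookup (schur_expansion (sum_list \<eta>) (fps_nth (H_series \<eta> \<gamma>) k)) \<mu>)"

text \<open>The blocks \<open>R\<^sub>0, \<dots>, R\<^bsub>t-1\<^esub>\<close> of consecutive entries of \<open>\<gamma>\<close>, of lengths given by \<open>\<eta>\<close>.\<close>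

definition block :: "nat list \<Rightarrow> int list \<Rightarrow> nat \<Rightarrow> int list" where
  "block \<eta> \<gamma> i = take (\<eta> ! i) (drop (sum_list (take i \<eta>)) \<gamma>)"

end

theory Submission
  imports Defs "Jordan_Normal_Form.Determinant"
begin

text \<open>
  Write \<open>D\<close>, \<open>D\<^sub>L\<close> and \<open>D\<^sub>R\<close> for the product of \<open>1 - x\<^sub>i/x\<^sub>j\<close> over all \<open>i < j\<close>, over the pairs within one
  block of \<open>\<eta>\<close>, and over \<open>Roots\<^sub>\<eta>\<close>. The coefficient of \<open>s\<^sub>\<lambda>\<close> in \<open>\<pi>(f)\<close> is \<open>\<langle>s\<^sub>\<lambda>, f D\<rangle>\<close>, where the pairing
  makes the monomials orthonormal. As \<open>D = D\<^sub>L D\<^sub>R\<close> and \<open>D\<^sub>R\<close> times the sum of the first coefficients of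
  \<open>B\<^sub>\<eta>\<close> is 1 up to monomials of very negative weight \<open>\<Sum> i a\<^sub>i\<close>, summing over the powers of \<open>q\<close> gives
  \<open>K(1) = \<langle>s\<^sub>\<lambda>, x\<^sup>\<gamma> D\<^sub>L\<rangle>\<close>.

  Let \<open>\<Phi>\<close> be the linear map sending \<open>x\<^sup>a\<close> to \<open>h\<^bsub>a\<^sub>1\<^esub> h\<^bsub>a\<^sub>2\<^esub> \<cdots>\<close>. By Jacobi--Trudi, applied to each
  block, \<open>\<Phi>(x\<^sup>\<gamma> D\<^sub>L)\<close> is the product of the \<open>s\<^bsub>R\<^sub>i\<^esub>\<close>. It remains that the coefficient of \<open>s\<^sub>\<lambda>\<close> in
  \<open>\<Phi>(f)\<close> is \<open>\<langle>s\<^sub>\<lambda>, f\<rangle>\<close>; by Jacobi--Trudi again this holds for \<open>f = x\<^sup>a D\<close> with \<open>a \<ge> 0\<close>, and these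
  functions reach all monomials by triangularity.
\<close>

abbreviation lookup :: "('a \<Rightarrow>\<^sub>0 'b::zero) \<Rightarrow> 'a \<Rightarrow> 'b" where
  "lookup \<equiv> Poly_Mapping.lookup"

abbreviation keys :: "('a \<Rightarrow>\<^sub>0 'b::zero) \<Rightarrow> 'a set" where
  "keys \<equiv> Poly_Mapping.keys"

subsection \<open>Supports of Laurent polynomials\<close>

definition supported :: "('a \<Rightarrow> bool) \<Rightarrow> ('a \<Rightarrow>\<^sub>0 int) \<Rightarrow> bool" where
  "supported P f \<longleftrightarrow> (\<forall>a\<in>keys f. P a)"

lemma supportedD: "supported P f \<Longrightarrow> lookup f a \<noteq> 0 \<Longrightarrow> P a"
  by (auto simp: supported_def in_keys_iff)

lemma supported_mono: "supported P f \<Longrightarrow> (\<And>a. P a \<Longrightarrow> Q a) \<Longrightarrow> supported Q f"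
  by (auto simp: supported_def)

lemma supported_zero [simp]: "supported P 0"
  by (simp add: supported_def)

lemma supported_monomial [simp]: "supported P (monomial a) \<longleftrightarrow> P a"
  by (simp add: supported_def monomial_def)

lemma monomial_0: "monomial 0 = 1"
  by (simp add: monomial_def)

lemma supported_one [simp]: "supported P (1 :: laurent) \<longleftrightarrow> P 0"
  by (simp flip: monomial_0)

lemma supported_add: "supported P f \<Longrightarrow> supported P g \<Longrightarrow> supported P (f + g)"
  using keys_add[of f g] by (auto simp: supported_def)

lemma supported_diff: "supported P f \<Longrightarrow> supported P g \<Longrightarrow> supported P (f - g)"
  using keys_diff[of f g] by (auto simp: supported_def)

lemma supported_cmul: "supported P f \<Longrightarrow> supported P (frag_cmul c f)"
  using keys_cmul[of c f] by (auto simp: supported_def)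

lemma supported_sum: "(\<And>i. i \<in> I \<Longrightarrow> supported P (f i)) \<Longrightarrow> supported P (\<Sum>i\<in>I. f i)"
  using keys_sum[of f I] by (fastforce simp: supported_def)

lemma supported_mult:
  fixes f g :: laurent
  assumes "supported P f" "supported Q g" "\<And>a b. P a \<Longrightarrow> Q b \<Longrightarrow> R (a + b)"
  shows "supported R (f * g)"
  using keys_mult[of f g] assms by (fastforce simp: supported_def)

lemma supported_prod:
  fixes f :: "'i \<Rightarrow> laurent"
  assumes "\<And>i. i \<in> I \<Longrightarrow> supported P (f i)" "P 0" "\<And>a b. P a \<Longrightarrow> P b \<Longrightarrow> P (a + b)"
  shows "supported P (\<Prod>i\<in>I. f i)"
  using assms(1)
  by (induction I rule: infinite_finite_induct) (auto intro: supported_mult assms(2,3))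

text \<open>As a group, \<open>laurent\<close> is the free abelian group on exponent vectors; this
  identity connects its ring operations with \<open>frag_cmul\<close>, \<open>frag_extend\<close>
  and the matching induction rule.\<close>

lemma of_int_mult_eq_frag_cmul: "of_int c * f = frag_cmul c (f :: laurent)"
proof -
  have *: "of_nat k * f = frag_cmul (int k) f" for k
    by (induction k) (simp_all add: ring_distribs frag_cmul_distrib)
  have "of_int (- int k) * f = frag_cmul (- int k) f" for k
    using *[of k] by (simp flip: minus_frag_cmul)
  with * show ?thesis
    by (cases c rule: int_cases2) auto
qed

lemma lookup_of_int_mult [simp]: "lookup (of_int c * f) a = c * lookup (f :: laurent) a"
  by (simp add: of_int_mult_eq_frag_cmul)

lemma frag_cmul_mult_right: "f * frag_cmul c g = frag_cmul c (f * g :: laurent)"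
  by (simp add: mult.left_commute flip: of_int_mult_eq_frag_cmul)

text \<open>The monomials with exponents in \<open>S\<close> generate all Laurent polynomials
  supported on \<open>S\<close> as an abelian group, and closure under differences yields both sums
  and negatives. Linear identities thus reduce to monomials.\<close>

lemma laurent_induction [consumes 1, case_names zero one diff]:
  assumes "supported S f" "P 0" "\<And>a. S a \<Longrightarrow> P (monomial a)"
    "\<And>f g. P f \<Longrightarrow> P g \<Longrightarrow> P (f - g)"
  shows "P f"
  using assms by (intro frag_induction[of f "Collect S" P]) (auto simp: supported_def monomial_def)

lemma monomial_add: "monomial (a + b) = monomial a * monomial b"
  by (simp add: monomial_def mult_single)

lemma monomial_sum: "monomial (\<Sum>i\<in>I. a i) = (\<Prod>i\<in>I. monomial (a i))"
  by (induction I rule: infinite_finite_induct) (simp_all add: monomial_0 monomial_add)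

lemma lookup_monomial: "lookup (monomial a) b = (if b = a then 1 else 0)"
  by (simp add: monomial_def)

lemma lookup_monomial_mult: "lookup (monomial e * f) a = lookup f (a - e)"
proof -
  have "supported (\<lambda>_. True) f" by (simp add: supported_def)
  then show ?thesis
  proof (induction rule: laurent_induction)
    case (one b)
    then show ?case
      by (auto simp flip: monomial_add simp: lookup_monomial algebra_simps)
  qed (simp_all add: lookup_minus right_diff_distrib)
qed

subsection \<open>Exponent vectors\<close>

definition expo :: "nat \<Rightarrow> nat \<Rightarrow> (nat \<Rightarrow> int) \<Rightarrow> (nat \<Rightarrow>\<^sub>0 int)" where
  "expo p m c = (\<Sum>i<m. Poly_Mapping.single (p + i) (c i))"

lemma lookup_expo: "lookup (expo p m c) k = (if p \<le> k \<and> k < p + m then c (k - p) else 0)"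
proof -
  have "lookup (expo p m c) k = (\<Sum>i<m. if i = k - p then (if p \<le> k then c (k - p) else 0) else 0)"
    unfolding expo_def lookup_sum lookup_single when_def by (intro sum.cong) auto
  then show ?thesis by auto
qed

lemma monomial_expo:
  "monomial (expo p m c) = (\<Prod>i<m. monomial (Poly_Mapping.single (p + i) (c i)))"
  by (simp add: expo_def monomial_sum)

lemma expo_add: "expo p m c + expo p m d = expo p m (\<lambda>i. c i + d i)"
  by (rule poly_mapping_eqI) (simp add: lookup_expo lookup_add)

lemma expo_eqI: "keys a \<subseteq> {..<n} \<Longrightarrow> (\<And>i. i < n \<Longrightarrow> lookup a i = c i) \<Longrightarrow> a = expo 0 n c"
  by (rule poly_mapping_eqI) (auto simp: lookup_expo in_keys_iff)

lemma keys_expo: "keys (expo p m c) \<subseteq> {p..<p + m}"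
  by (auto simp: in_keys_iff lookup_expo split: if_splits)

lemma keys_add_subset: "keys a \<subseteq> A \<Longrightarrow> keys b \<subseteq> A \<Longrightarrow> keys (a + b :: nat \<Rightarrow>\<^sub>0 int) \<subseteq> A"
  using keys_add[of a b] by blast

lemma keys_diff_subset: "keys a \<subseteq> A \<Longrightarrow> keys b \<subseteq> A \<Longrightarrow> keys (a - b :: nat \<Rightarrow>\<^sub>0 int) \<subseteq> A"
  using keys_diff[of a b] by blast

lemma lookup_nth_list: "lookup (Poly_Mapping.nth xs) i = (if i < length xs then xs ! i else 0)"
  by (simp add: nth_default_def)

lemma keys_nth_subset: "length xs \<le> n \<Longrightarrow> keys (Poly_Mapping.nth xs :: nat \<Rightarrow>\<^sub>0 int) \<subseteq> {..<n}"
  by (auto simp: in_keys_iff lookup_nth_list simp del: lookup_nth keys_nth split: if_splits)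

lemma rho_nth: "i < n \<Longrightarrow> rho n ! i = int n - 1 - int i"
  by (simp add: rho_def rev_nth of_nat_diff)

lemma length_rho [simp]: "length (rho n) = n"
  by (simp add: rho_def)

abbreviation rho_exp :: "nat \<Rightarrow> nat \<Rightarrow>\<^sub>0 int" where
  "rho_exp n \<equiv> Poly_Mapping.nth (rho n)"

lemma lookup_rho: "i < n \<Longrightarrow> lookup (rho_exp n) i = int n - 1 - int i"
  by (simp add: lookup_nth_list rho_nth del: lookup_nth)

lemma keys_rho: "keys (rho_exp n) \<subseteq> {..<n}"
  by (rule keys_nth_subset) simp

subsection \<open>Antisymmetrization\<close>

lemma lookup_map_key: "inj w \<Longrightarrow> lookup (Poly_Mapping.map_key w a) i = lookup a (w i)"
  by (simp add: map_key.rep_eq)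

lemma inj_map_key:
  assumes "bij w"
  shows "inj (Poly_Mapping.map_key w :: (nat \<Rightarrow>\<^sub>0 int) \<Rightarrow> _)"
proof (rule injI)
  fix a b :: "nat \<Rightarrow>\<^sub>0 int"
  assume eq: "Poly_Mapping.map_key w a = Poly_Mapping.map_key w b"
  have "lookup a (w i) = lookup b (w i)" for i
    using arg_cong[OF eq, of "\<lambda>p. lookup p i"] assms by (simp add: lookup_map_key bij_is_inj)
  then show "a = b"
    by (metis poly_mapping_eqI bij_is_surj[OF assms] surjD)
qed

lemma lookup_permute_vars:
  "bij w \<Longrightarrow> lookup (permute_vars w f) a = lookup f (Poly_Mapping.map_key w a)"
  by (simp add: permute_vars_def inj_map_key lookup_map_key)

lemma lookup_antisymmetrize:
  "lookup (antisymmetrize n f) a =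
    (\<Sum>w | w permutes {..<n}. sign w * lookup f (Poly_Mapping.map_key w a))"
  by (auto simp: antisymmetrize_def lookup_sum permutes_bij lookup_permute_vars intro!: sum.cong)

lemma antisymmetrize_diff: "antisymmetrize n (f - g) = antisymmetrize n f - antisymmetrize n g"
  by (rule poly_mapping_eqI)
    (simp add: lookup_antisymmetrize lookup_minus right_diff_distrib sum_subtractf)

lemma antisymmetrize_0 [simp]: "antisymmetrize n 0 = 0"
  using antisymmetrize_diff[of n 0 0] by simp

lemma map_key_inv_eq:
  assumes "bij v"
  shows "Poly_Mapping.map_key (Hilbert_Choice.inv v) a = b \<longleftrightarrow> a = Poly_Mapping.map_key v (b :: nat \<Rightarrow>\<^sub>0 int)"
proof -
  have inj: "inj v" "inj (Hilbert_Choice.inv v)"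
    using assms by (simp_all add: bij_is_inj bij_imp_bij_inv)
  have "v \<circ> Hilbert_Choice.inv v = (\<lambda>x. x)" "(\<lambda>x. Hilbert_Choice.inv v (v x)) = (\<lambda>x. x)"
    using assms by (auto simp: fun_eq_iff bij_def surj_f_inv_f)
  then have "Poly_Mapping.map_key (Hilbert_Choice.inv v) (Poly_Mapping.map_key v b) = b"
    "Poly_Mapping.map_key v (Poly_Mapping.map_key (Hilbert_Choice.inv v) a) = a"
    using inj by (simp_all add: map_key_compose map_key_id o_def)
  then show ?thesis by metis
qed

text \<open>The coefficient of \<open>x^a\<close> in \<open>J(x^b)\<close> sums the signs of the
  \<open>w\<close> carrying \<open>a\<close> to \<open>b\<close>; replacing \<open>w\<close> by its
  inverse exchanges \<open>a\<close> and \<open>b\<close>.\<close>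

lemma antisymmetrize_monomial_symmetric:
  "lookup (antisymmetrize n (monomial b)) a = lookup (antisymmetrize n (monomial a)) b"
proof -
  have "lookup (antisymmetrize n (monomial b)) a =
    (\<Sum>w | w permutes {..<n}. sign (Hilbert_Choice.inv w) *
       lookup (monomial b) (Poly_Mapping.map_key (Hilbert_Choice.inv w) a))"
    unfolding lookup_antisymmetrize by (rule sum_permutations_inverse)
  also have "\<dots> = (\<Sum>w | w permutes {..<n}. sign w * lookup (monomial a) (Poly_Mapping.map_key w b))"
    by (intro sum.cong) (auto simp: permutes_bij lookup_monomial map_key_inv_eq
        intro!: sign_inverse permutes_imp_permutation[OF finite_lessThan])
  finally show ?thesis by (simp add: lookup_antisymmetrize)
qed

lemma antisymmetrize_monomial_permuted:
  assumes v: "v permutes {..<n}"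
  shows "antisymmetrize n (monomial (Poly_Mapping.map_key v b)) =
    of_int (sign v) * antisymmetrize n (monomial b)"
proof (rule poly_mapping_eqI)
  fix a
  have perm: "permutation w" if "w permutes {..<n}" for w
    using that permutation_permutes by blast
  have "lookup (antisymmetrize n (monomial (Poly_Mapping.map_key v b))) a =
    (\<Sum>u | u permutes {..<n}. sign (u \<circ> v) *
       lookup (monomial (Poly_Mapping.map_key v b)) (Poly_Mapping.map_key (u \<circ> v) a))"
    unfolding lookup_antisymmetrize by (rule sum_permutations_compose_right[OF v])
  also have "\<dots> = (\<Sum>u | u permutes {..<n}. sign v * (sign u *
       lookup (monomial b) (Poly_Mapping.map_key u a)))"
  proof (intro sum.cong refl)
    fix u assume "u \<in> {u. u permutes {..<n}}"
    then have u: "u permutes {..<n}" by simp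
    have "Poly_Mapping.map_key (u \<circ> v) a = Poly_Mapping.map_key v (Poly_Mapping.map_key u a)"
      using u v by (simp add: map_key_compose permutes_inj)
    then have "Poly_Mapping.map_key (u \<circ> v) a = Poly_Mapping.map_key v b
        \<longleftrightarrow> Poly_Mapping.map_key u a = b"
      using inj_map_key[OF permutes_bij[OF v]] by (simp add: inj_eq)
    then show "sign (u \<circ> v) *
       lookup (monomial (Poly_Mapping.map_key v b)) (Poly_Mapping.map_key (u \<circ> v) a) =
       sign v * (sign u * lookup (monomial b) (Poly_Mapping.map_key u a))"
      using u v by (simp add: sign_compose perm lookup_monomial)
  qed
  finally show "lookup (antisymmetrize n (monomial (Poly_Mapping.map_key v b))) a =
    lookup (of_int (sign v) * antisymmetrize n (monomial b)) a"
    by (simp add: lookup_antisymmetrize sum_distrib_left)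
qed

text \<open>The transposition of \<open>i\<close> and \<open>j\<close> fixes \<open>b\<close>, so
  \<open>J(x^b)\<close> equals its own negative, and the integer coefficients have no
  2-torsion.\<close>

lemma antisymmetrize_monomial_eq_0:
  assumes "i < n" "j < n" "i \<noteq> j" "lookup b i = lookup b j"
  shows "antisymmetrize n (monomial b) = 0"
proof -
  let ?v = "Transposition.transpose i j"
  have v: "?v permutes {..<n}" using assms by (simp add: permutes_swap_id)
  have "Poly_Mapping.map_key ?v b = b"
    by (rule poly_mapping_eqI)
      (use assms in \<open>auto simp: lookup_map_key Transposition.transpose_def\<close>)
  with antisymmetrize_monomial_permuted[OF v, of b] assms
  have "antisymmetrize n (monomial b) = - antisymmetrize n (monomial b)"
    by (simp add: sign_swap_id)
  then show ?thesis
    by (metis (no_types, lifting) equal_neg_zero lookup_uminus lookup_zero poly_mapping_eqI)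
qed

lemma antisymmetrize_shift:
  assumes "\<And>w. w permutes {..<n} \<Longrightarrow> Poly_Mapping.map_key w e = e"
  shows "antisymmetrize n (monomial e * f) = monomial e * antisymmetrize n f"
proof (rule poly_mapping_eqI)
  fix a
  have "Poly_Mapping.map_key w (a - e) = Poly_Mapping.map_key w a - e" if "w permutes {..<n}" for w
    by (rule poly_mapping_eqI)
      (use assms[OF that] permutes_inj[OF that] in \<open>metis lookup_map_key lookup_minus\<close>)
  then show "lookup (antisymmetrize n (monomial e * f)) a = lookup (monomial e * antisymmetrize n f) a"
    by (simp add: lookup_monomial_mult lookup_antisymmetrize)
qed

text \<open>This is the Leibniz expansion of the determinant with entries \<open>x_j^(b_i)\<close>,
  to which matrix factorizations apply.\<close>

lemma antisymmetrize_monomial_det: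
  assumes "keys b \<subseteq> {..<n}"
  shows "antisymmetrize n (monomial b) =
    (\<Sum>w | w permutes {..<n}. of_int (sign w) *
       (\<Prod>i<n. monomial (Poly_Mapping.single (w i) (lookup b i))))"
  unfolding antisymmetrize_def
proof (intro sum.cong arg_cong2[of _ _ _ _ "(*)"] refl)
  fix w assume "w \<in> {w. w permutes {..<n}}"
  then have w: "w permutes {..<n}" by simp
  \<comment> \<open>\<open>c\<close> is \<open>b\<close> moved along \<open>w\<close>: the variable
    \<open>w i\<close> receives the exponent of the variable \<open>i\<close>.\<close>
  define c where "c = (\<Sum>i<n. Poly_Mapping.single (w i) (lookup b i))"
  have "lookup c (w k) = lookup b k" for k
  proof -
    have "lookup c (w k) = (\<Sum>i<n. lookup b i when i = k)"
      using permutes_inj[OF w] by (simp add: c_def lookup_sum lookup_single inj_eq)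
    also have "\<dots> = lookup b k"
      using assms by (auto simp: when_def in_keys_iff)
    finally show ?thesis .
  qed
  then have "Poly_Mapping.map_key w c = b"
    by (intro poly_mapping_eqI) (simp add: lookup_map_key permutes_inj[OF w])
  then have "Poly_Mapping.map_key w a = b \<longleftrightarrow> a = c" for a
    using inj_map_key[OF permutes_bij[OF w]] by (metis injD)
  then have "permute_vars w (monomial b) = monomial c"
    by (intro poly_mapping_eqI) (simp add: lookup_permute_vars permutes_bij[OF w] lookup_monomial)
  then show "permute_vars w (monomial b) = (\<Prod>i<n. monomial (Poly_Mapping.single (w i) (lookup b i)))"
    by (simp add: c_def monomial_sum)
qed

subsection \<open>The Vandermonde determinant\<close>

text \<open>The values of the monic polynomials \<open>p j\<close>, with roots
  \<open>y 0, ..., y (j - 1)\<close>, at the points \<open>y i\<close> form a lower triangular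
  matrix \<open>P\<close>. It factors as the Vandermonde matrix \<open>V\<close> times the
  unitriangular matrix \<open>C\<close> of coefficients.\<close>

lemma vandermonde:
  fixes y :: "nat \<Rightarrow> 'a::idom"
  shows "(\<Prod>j<m. \<Prod>i<j. y j - y i) =
    (\<Sum>w | w permutes {..<m}. of_int (sign w) * (\<Prod>i<m. y i ^ w i))"
proof -
  define p where "p j = (\<Prod>k<j. [:- y k, 1:])" for j
  have deg: "degree (p j) = j" for j
    by (simp add: p_def degree_prod_sum_eq)
  have monic: "coeff (p j) j = 1" for j
    using lead_coeff_prod[of "\<lambda>k. [:- y k, 1:]" "{..<j}"] deg[of j] by (simp add: p_def)
  define V where "V = mat m m (\<lambda>(i, j). y i ^ j)"
  define C where "C = mat m m (\<lambda>(l, j). coeff (p j) l)"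
  define P where "P = mat m m (\<lambda>(i, j). poly (p j) (y i))"
  have dim: "V \<in> carrier_mat m m" "C \<in> carrier_mat m m" "P \<in> carrier_mat m m"
    by (simp_all add: V_def C_def P_def)
  have "P = V * C"
  proof (rule eq_matI)
    fix i j assume "i < dim_row (V * C)" "j < dim_col (V * C)"
    then have ij: "i < m" "j < m" by (simp_all add: V_def C_def)
    have "poly (p j) (y i) = (\<Sum>l\<le>j. coeff (p j) l * y i ^ l)"
      by (simp add: poly_altdef deg)
    also have "\<dots> = (\<Sum>l<m. coeff (p j) l * y i ^ l)"
      using ij deg by (intro sum.mono_neutral_left) (auto simp: coeff_eq_0)
    finally show "P $$ (i, j) = (V * C) $$ (i, j)"
      using ij by (simp add: P_def V_def C_def scalar_prod_def mult.commute atLeast0LessThan)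
  qed (simp_all add: P_def V_def C_def)
  then have "det P = det V * det C" by (simp add: det_mult[OF dim(1,2)])
  moreover have "det C = 1"
  proof -
    have "det C = prod_list (diag_mat C)"
      by (rule det_upper_triangular[OF _ dim(2)]) (auto simp: C_def coeff_eq_0 deg)
    then show ?thesis by (simp add: prod_list_diag_prod C_def monic)
  qed
  moreover have "det P = (\<Prod>j<m. \<Prod>i<j. y j - y i)"
  proof -
    have "det P = prod_list (diag_mat P)"
      by (rule det_lower_triangular[OF _ dim(3)]) (auto simp: P_def p_def poly_prod)
    then show ?thesis by (simp add: prod_list_diag_prod P_def p_def poly_prod atLeast0LessThan)
  qed
  moreover have "det V = (\<Sum>w | w permutes {..<m}. of_int (sign w) * (\<Prod>i<m. y i ^ w i))"
    unfolding det_def'[OF dim(1)] atLeast0LessThan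
  proof (intro sum.cong refl)
    fix w assume "w \<in> {w. w permutes {..<m}}"
    then have "w i < m" if "i < m" for i
      using that permutes_in_image[of w "{..<m}" i] by auto
    then show "signof w * (\<Prod>i<m. V $$ (i, w i)) = of_int (sign w) * (\<Prod>i<m. y i ^ w i)"
      by (simp add: V_def)
  qed
  ultimately show ?thesis by simp
qed

lemma monomial_single_power:
  "monomial (Poly_Mapping.single i 1) ^ k = monomial (Poly_Mapping.single i (int k))"
  by (induction k) (simp_all add: monomial_0 ac_simps single_add flip: monomial_add)

definition root_exp :: "nat \<Rightarrow> nat \<Rightarrow> nat \<Rightarrow>\<^sub>0 int" where
  "root_exp i j = Poly_Mapping.single i 1 - Poly_Mapping.single j 1"

text \<open>The Weyl denominator of the block of \<open>m\<close> variables starting at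
  \<open>p\<close>, scaled to have constant term 1.\<close>

definition block_denom :: "nat \<Rightarrow> nat \<Rightarrow> laurent" where
  "block_denom p m = (\<Prod>j<m. \<Prod>i<j. 1 - monomial (root_exp (p + i) (p + j)))"

text \<open>The Weyl denominator formula: since \<open>y j - y i = y j * (1 - y i / y j)\<close>,
  the Vandermonde product is \<open>\<Prod>j<m. y j ^ j\<close> times the denominator, and the shift
  by \<open>- int i\<close> removes that monomial.\<close>

lemma monomial_mult_block_denom:
  "monomial (expo p m c) * block_denom p m =
    (\<Sum>w | w permutes {..<m}. of_int (sign w) *
       monomial (expo p m (\<lambda>i. c i - int i + int (w i))))"
proof -
  define y where "y i = monomial (Poly_Mapping.single (p + i) 1)" for i
  have y_pow: "(\<Prod>i<m. y i ^ k i) = monomial (expo p m (\<lambda>i. int (k i)))" for k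
    by (simp add: y_def monomial_single_power monomial_expo)
  have "y j - y i = y j * (1 - monomial (root_exp (p + i) (p + j)))" for i j
    by (simp add: y_def root_exp_def right_diff_distrib flip: monomial_add)
  then have "(\<Prod>j<m. \<Prod>i<j. y j - y i) = (\<Prod>j<m. y j ^ j) * block_denom p m"
    by (simp add: block_denom_def prod.distrib)
  then have "monomial (expo p m (\<lambda>i. c i - int i)) * (monomial (expo p m int) * block_denom p m) =
      monomial (expo p m (\<lambda>i. c i - int i)) *
        (\<Sum>w | w permutes {..<m}. of_int (sign w) * monomial (expo p m (\<lambda>i. int (w i))))"
    by (simp add: vandermonde y_pow)
  also have "\<dots> = (\<Sum>w | w permutes {..<m}. of_int (sign w) *
       (monomial (expo p m (\<lambda>i. c i - int i)) * monomial (expo p m (\<lambda>i. int (w i)))))"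
    by (simp add: sum_distrib_left mult.left_commute)
  finally show ?thesis
    by (simp add: expo_add mult.assoc[symmetric] flip: monomial_add)
qed

subsection \<open>Products of geometric series\<close>

abbreviation linear_factor :: "laurent \<Rightarrow> laurent fps" where
  "linear_factor u \<equiv> 1 - fps_X * fps_const u"

text \<open>Depending on \<open>u\<close>, this is \<open>B_series\<close> or the generating
  function of the complete homogeneous polynomials.\<close>

definition geom_prod :: "'i set \<Rightarrow> ('i \<Rightarrow> laurent) \<Rightarrow> laurent fps" where
  "geom_prod A u = (\<Prod>\<alpha>\<in>A. fps_left_inverse (linear_factor (u \<alpha>)) 1)"

lemma geom_prod_inverse: "geom_prod A u * (\<Prod>\<alpha>\<in>A. linear_factor (u \<alpha>)) = 1"
proof -
  have "fps_left_inverse (linear_factor (u \<alpha>)) 1 * linear_factor (u \<alpha>) = 1" for \<alpha>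
    by (rule fps_left_inverse) simp
  then show ?thesis
    by (simp add: geom_prod_def flip: prod.distrib)
qed

lemma geom_prod_empty: "geom_prod {} u = 1"
  by (simp add: geom_prod_def)

lemma geom_prod_insert:
  assumes "finite A" "\<alpha> \<notin> A"
  shows "linear_factor (u \<alpha>) * geom_prod (insert \<alpha> A) u = geom_prod A u"
proof -
  have "fps_left_inverse (linear_factor (u \<alpha>)) 1 * linear_factor (u \<alpha>) = 1"
    by (rule fps_left_inverse) simp
  then show ?thesis
    using assms by (simp add: geom_prod_def mult.assoc[symmetric] mult.commute)
qed

lemma linear_factor_mult_nth:
  "fps_nth (linear_factor c * f) 0 = fps_nth f 0"
  "fps_nth (linear_factor c * f) (Suc k) = fps_nth f (Suc k) - c * fps_nth f k"
  by (simp_all add: left_diff_distrib mult.assoc)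

lemma geom_prod_nth_0: "finite A \<Longrightarrow> fps_nth (geom_prod A u) 0 = 1"
proof (induction A rule: finite_induct)
  case (insert \<alpha> A)
  then show ?case
    using arg_cong[OF geom_prod_insert[OF insert(1,2), of u], of "\<lambda>f. fps_nth f 0"]
    by (simp add: linear_factor_mult_nth)
qed (simp add: geom_prod_empty)

lemma geom_prod_insert_nth_Suc:
  assumes "finite A" "\<alpha> \<notin> A"
  shows "fps_nth (geom_prod (insert \<alpha> A) u) (Suc k) =
    fps_nth (geom_prod A u) (Suc k) + u \<alpha> * fps_nth (geom_prod (insert \<alpha> A) u) k"
  using arg_cong[OF geom_prod_insert[OF assms, of u], of "\<lambda>f. fps_nth f (Suc k)"]
  by (simp only: linear_factor_mult_nth) (simp add: algebra_simps)

text \<open>The coefficient of \<open>q^k\<close> is a sum of products of \<open>k\<close> of the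
  elements \<open>u \<alpha>\<close>; the recursion \<open>geom_prod_insert_nth_Suc\<close> builds
  it up by induction on \<open>A\<close> and \<open>k\<close>.\<close>

lemma geom_prod_nth_induct:
  assumes "finite A" "P 0 1" "\<And>k. P k 0" "\<And>k f g. P k f \<Longrightarrow> P k g \<Longrightarrow> P k (f + g)"
    "\<And>k \<alpha> f. \<alpha> \<in> A \<Longrightarrow> P k f \<Longrightarrow> P (Suc k) (u \<alpha> * f)"
  shows "P k (fps_nth (geom_prod A u) k)"
  using assms(1,5)
proof (induction A arbitrary: k rule: finite_induct)
  case empty
  then show ?case using assms(2,3) by (cases k) (simp_all add: geom_prod_empty)
next
  case (insert \<alpha> A)
  show ?case
  proof (induction k)
    case 0
    then show ?case using assms(2) insert(1) by (simp add: geom_prod_nth_0)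
  next
    case (Suc k)
    then show ?case
      using insert by (simp add: geom_prod_insert_nth_Suc assms(4))
  qed
qed

lemma prod_linear_factor_nth_eq_0:
  "finite A \<Longrightarrow> card A < l \<Longrightarrow> fps_nth (\<Prod>\<alpha>\<in>A. linear_factor (u \<alpha>)) l = 0"
proof (induction A arbitrary: l rule: finite_induct)
  case (insert \<alpha> A)
  then obtain k where "l = Suc k" "card A < k" by (cases l) auto
  with insert show ?case by (simp add: linear_factor_mult_nth del: fps_mult_nth_1)
qed auto

lemma linear_factor_mult_powers: "linear_factor c * Abs_fps (\<lambda>b. c ^ b) = 1"
proof (rule fps_ext)
  fix k show "fps_nth (linear_factor c * Abs_fps (\<lambda>b. c ^ b)) k = fps_nth 1 k"
    by (cases k) (simp_all only: linear_factor_mult_nth, simp_all)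
qed

subsection \<open>Complete homogeneous polynomials and the Jacobi--Trudi formula\<close>

text \<open>The complete homogeneous polynomial \<open>h_k\<close>, with the convention
  \<open>h_k = 0\<close> for negative \<open>k\<close> that the Jacobi--Trudi determinant
  uses.\<close>

definition complete_hom :: "nat \<Rightarrow> int \<Rightarrow> laurent" where
  "complete_hom n k = (if k < 0 then 0 else
     fps_nth (geom_prod {..<n} (\<lambda>i. monomial (Poly_Mapping.single i 1))) (nat k))"

lemma complete_hom_0 [simp]: "complete_hom n 0 = 1"
  by (simp add: complete_hom_def geom_prod_nth_0)

lemma complete_hom_neg: "k < 0 \<Longrightarrow> complete_hom n k = 0"
  by (simp add: complete_hom_def)

definition polynomial_exp :: "nat \<Rightarrow> (nat \<Rightarrow>\<^sub>0 int) \<Rightarrow> bool" where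
  "polynomial_exp n a \<longleftrightarrow> keys a \<subseteq> {..<n} \<and> (\<forall>i. 0 \<le> lookup a i)"

lemma polynomial_exp_add: "polynomial_exp n a \<Longrightarrow> polynomial_exp n b \<Longrightarrow> polynomial_exp n (a + b)"
  by (simp add: polynomial_exp_def keys_add_subset lookup_add)

lemma supported_complete_hom: "supported (polynomial_exp n) (complete_hom n k)"
proof (cases "k < 0")
  case False
  have "supported (polynomial_exp n) (fps_nth (geom_prod {..<n} (\<lambda>i. monomial (Poly_Mapping.single i 1))) (nat k))"
  proof (rule geom_prod_nth_induct)
    fix i f assume "i \<in> {..<n}" "supported (polynomial_exp n) f"
    then show "supported (polynomial_exp n) (monomial (Poly_Mapping.single i 1) * f)"
      by (intro supported_mult[of "polynomial_exp n" _ "polynomial_exp n"] polynomial_exp_add)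
        (auto simp: polynomial_exp_def lookup_single when_def)
  qed (auto simp: polynomial_exp_def intro: supported_add)
  with False show ?thesis by (simp add: complete_hom_def)
qed (simp add: complete_hom_neg)

text \<open>The Jacobi--Trudi determinant, kept as a Leibniz sum because \<open>hom_map\<close>
  produces it in this form from a multiple of \<open>block_denom\<close>.\<close>

definition hom_det :: "nat \<Rightarrow> nat \<Rightarrow> (nat \<Rightarrow> int) \<Rightarrow> laurent" where
  "hom_det n m c = (\<Sum>w | w permutes {..<m}. of_int (sign w) *
     (\<Prod>i<m. complete_hom n (c i - int i + int (w i))))"

lemma hom_det_eq_det:
  "hom_det n m c = det (mat m m (\<lambda>(i, k). complete_hom n (c i - int i + int k)))"
proof -
  have *: "mat m m (\<lambda>(i, k). complete_hom n (c i - int i + int k)) \<in> carrier_mat m m" by simp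
  show ?thesis
    unfolding det_def'[OF *] hom_det_def atLeast0LessThan
  proof (intro sum.cong refl)
    fix w assume "w \<in> {w. w permutes {..<m}}"
    then have "w i < m" if "i < m" for i
      using that permutes_in_image[of w "{..<m}" i] by auto
    then show "of_int (sign w) * (\<Prod>i<m. complete_hom n (c i - int i + int (w i))) =
      signof w * (\<Prod>i<m. mat m m (\<lambda>(i, k). complete_hom n (c i - int i + int k)) $$ (i, w i))"
      by simp
  qed
qed

lemma hom_det_0: "hom_det n m (\<lambda>_. 0) = 1"
proof -
  let ?H = "mat m m (\<lambda>(i, k). complete_hom n (- int i + int k))"
  have "det ?H = prod_list (diag_mat ?H)"
    by (rule det_upper_triangular[of _ m]) (auto simp: complete_hom_neg)
  then show ?thesis by (simp add: hom_det_eq_det prod_list_diag_prod)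
qed

text \<open>The last row consists of \<open>h_(k - m)\<close> with \<open>k \<le> m\<close>, so it
  is zero except for \<open>h_0 = 1\<close> on the diagonal; only permutations fixing
  \<open>m\<close> contribute.\<close>

lemma hom_det_Suc:
  assumes "c m = 0"
  shows "hom_det n (Suc m) c = hom_det n m c"
proof -
  let ?t = "\<lambda>m w. of_int (sign w) * (\<Prod>i<m. complete_hom n (c i - int i + int (w i)))"
  have "hom_det n (Suc m) c = (\<Sum>w | w permutes {..<m}. ?t (Suc m) w)"
    unfolding hom_det_def
  proof (rule sum.mono_neutral_right)
    show "{w. w permutes {..<m}} \<subseteq> {w. w permutes {..<Suc m}}"
      by (auto intro: permutes_subset)
    show "\<forall>w\<in>{w. w permutes {..<Suc m}} - {w. w permutes {..<m}}. ?t (Suc m) w = 0"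
    proof
      fix w assume w: "w \<in> {w. w permutes {..<Suc m}} - {w. w permutes {..<m}}"
      then have "w m \<noteq> m"
        using permutes_superset[of w "{..<Suc m}" "{..<m}"] by (auto simp: less_Suc_eq)
      moreover have "w m < Suc m"
        using w permutes_in_image[of w "{..<Suc m}" m] by auto
      ultimately show "?t (Suc m) w = 0"
        by (simp add: assms complete_hom_neg)
    qed
  qed (simp add: finite_permutations)
  also have "\<dots> = hom_det n m c"
    unfolding hom_det_def by (intro sum.cong) (auto simp: assms permutes_def)
  finally show ?thesis .
qed

lemma hom_det_pad:
  assumes "m \<le> n" "\<And>i. m \<le> i \<Longrightarrow> c i = 0"
  shows "hom_det k n c = hom_det k m c"
  using assms by (induction n rule: dec_induct) (simp_all add: hom_det_Suc)

text \<open>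
  Extracting coefficients from \<open>\<Prod>\<^sub>i (1 - x\<^sub>i t)\<^sup>-\<^sup>1 \<cdot> \<Prod>\<^bsub>i \<noteq> j\<^esub> (1 - x\<^sub>i t) = (1 - x\<^sub>j t)\<^sup>-\<^sup>1\<close>
  factors the matrix of the \<open>x\<^sub>j\<^sup>b\<close>.
\<close>

lemma antisymmetrize_eq_hom_det:
  assumes "\<And>i. i < n \<Longrightarrow> 0 \<le> c i + (int n - 1 - int i)"
  shows "antisymmetrize n (monomial (expo 0 n (\<lambda>i. c i + (int n - 1 - int i)))) =
    antisymmetrize n (xpow (rho n)) * hom_det n n c"
proof -
  define x where "x j = monomial (Poly_Mapping.single j 1)" for j :: nat
  \<comment> \<open>Up to sign, the coefficients of \<open>E j\<close> are the elementary symmetric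
    polynomials in the variables other than \<open>x j\<close>; \<open>M\<close> lists them in
    reverse order.\<close>
  define E where "E j = (\<Prod>i\<in>{..<n} - {j}. linear_factor (x i))" for j
  define M where "M = mat n n (\<lambda>(k, j). fps_nth (E j) (n - Suc k))"
  have power_eq: "x j ^ b = (\<Sum>k<n. complete_hom n (int b - int (n - Suc k)) * fps_nth (E j) (n - Suc k))"
    if j: "j < n" for j b
  proof -
    let ?G = "geom_prod {..<n} x"
    have E_0: "fps_nth (E j) l = 0" if "n \<le> l" for l
      unfolding E_def using that j by (intro prod_linear_factor_nth_eq_0) auto
    have "?G * E j * linear_factor (x j) = 1"
      using j geom_prod_inverse[of "{..<n}" x]
      by (simp add: E_def prod.remove[of "{..<n}" j] ac_simps)
    then have "?G * E j = ?G * E j * (linear_factor (x j) * Abs_fps (\<lambda>b. x j ^ b))"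
      by (simp add: linear_factor_mult_powers)
    also have "\<dots> = Abs_fps (\<lambda>b. x j ^ b)"
      using \<open>?G * E j * linear_factor (x j) = 1\<close> by (simp flip: mult.assoc)
    finally have "x j ^ b = fps_nth (E j * ?G) b"
      by (simp add: mult.commute)
    also have "\<dots> = (\<Sum>l\<in>{0..b}. complete_hom n (int b - int l) * fps_nth (E j) l)"
      by (auto simp: fps_mult_nth complete_hom_def x_def[abs_def] mult.commute nat_diff_distrib
          intro!: sum.cong)
    \<comment> \<open>The two summation ranges agree: for \<open>l > b\<close> the index of
      \<open>h\<close> is negative, and \<open>E j\<close> has degree below
      \<open>n\<close>.\<close>
    also have "\<dots> = (\<Sum>l\<in>{..<n} \<union> {0..b}. complete_hom n (int b - int l) * fps_nth (E j) l)"
      by (intro sum.mono_neutral_left) (auto simp: complete_hom_neg)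
    also have "\<dots> = (\<Sum>l<n. complete_hom n (int b - int l) * fps_nth (E j) l)"
      by (intro sum.mono_neutral_right) (auto simp: E_0)
    also have "\<dots> = (\<Sum>k<n. complete_hom n (int b - int (n - Suc k)) * fps_nth (E j) (n - Suc k))"
      by (rule sum.nat_diff_reindex[symmetric])
    finally show ?thesis .
  qed
  have factor: "antisymmetrize n (monomial (expo 0 n (\<lambda>i. c i + (int n - 1 - int i)))) =
      hom_det n n c * det M"
    if c: "\<And>i. i < n \<Longrightarrow> 0 \<le> c i + (int n - 1 - int i)" for c
  proof -
    define b where "b i = nat (c i + (int n - 1 - int i))" for i
    define H where "H = mat n n (\<lambda>(i, k). complete_hom n (c i - int i + int k))"
    define A where "A = mat n n (\<lambda>(i, j). x j ^ b i)"
    have "A = H * M"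
    proof (rule eq_matI)
      fix i j assume "i < dim_row (H * M)" "j < dim_col (H * M)"
      then have ij: "i < n" "j < n" by (simp_all add: H_def M_def)
      \<comment> \<open>The reversed order in \<open>M\<close> is what turns
        \<open>h_(b - l)\<close> into the Jacobi--Trudi entry.\<close>
      have "int (b i) - int (n - Suc k) = c i - int i + int k" if "k < n" for k
        using that c[OF ij(1)] by (simp add: b_def of_nat_diff)
      then have "x j ^ b i =
          (\<Sum>k<n. complete_hom n (c i - int i + int k) * fps_nth (E j) (n - Suc k))"
        unfolding power_eq[OF ij(2)] by (intro sum.cong refl) (simp only: lessThan_iff)
      with ij show "A $$ (i, j) = (H * M) $$ (i, j)"
        by (simp add: A_def H_def M_def scalar_prod_def atLeast0LessThan)
    qed (simp_all add: A_def H_def M_def)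
    then have "det A = det H * det M"
      by (simp add: det_mult[of _ n] H_def M_def)
    moreover have A: "A \<in> carrier_mat n n" by (simp add: A_def)
    have "det A = antisymmetrize n (monomial (expo 0 n (\<lambda>i. c i + (int n - 1 - int i))))"
      unfolding det_def'[OF A] atLeast0LessThan
        antisymmetrize_monomial_det[OF keys_expo[of 0 n, simplified atLeast0LessThan add_0]]
    proof (intro sum.cong refl)
      fix w assume "w \<in> {w. w permutes {..<n}}"
      then have "w i < n" if "i < n" for i
        using that permutes_in_image[of w "{..<n}" i] by auto
      with c show "signof w * (\<Prod>i<n. A $$ (i, w i)) = of_int (sign w) *
         (\<Prod>i<n. monomial (Poly_Mapping.single (w i)
            (lookup (expo 0 n (\<lambda>i. c i + (int n - 1 - int i))) i)))"
        by (simp add: A_def x_def monomial_single_power b_def lookup_expo)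
    qed
    ultimately show ?thesis by (simp add: hom_det_eq_det H_def)
  qed
  \<comment> \<open>The case \<open>c = 0\<close>, in which the determinant of the \<open>h\<close>
    is 1, identifies \<open>det M\<close> with \<open>J(x^\<rho>)\<close>.\<close>
  have "rho_exp n = expo 0 n (\<lambda>i. 0 + (int n - 1 - int i))"
    by (rule expo_eqI[OF keys_rho]) (simp add: lookup_rho del: lookup_nth)
  then have "antisymmetrize n (xpow (rho n)) = det M"
    using factor[of "\<lambda>_. 0"] by (simp add: xpow_def hom_det_0)
  then show ?thesis
    using factor[of c] assms by (simp add: mult.commute)
qed

subsection \<open>Division by the antisymmetrized Weyl vector\<close>

text \<open>Strict growth gives \<open>i \<le> w i\<close>, and the sums of all \<open>i\<close> and
  of all \<open>w i\<close> agree, so every inequality is an equality.\<close>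

lemma strict_mono_permutation_eq_id:
  assumes w: "w permutes {..<n}" and mono: "\<And>i j. i < j \<Longrightarrow> j < n \<Longrightarrow> w i < (w j :: nat)"
  shows "w = id"
proof -
  have le: "i \<le> w i" if "i < n" for i
    using that
  proof (induction i)
    case (Suc i)
    with mono[of i "Suc i"] show ?case by simp
  qed simp
  have "(\<Sum>i<n. i) = (\<Sum>i<n. w i)"
    using sum.permute[OF w, of "\<lambda>i. i"] by (simp add: o_def)
  then have "i = w i" if "i < n" for i
    using that le by (intro sum_mono_inv[of "\<lambda>i. i" "{..<n}" w]) auto
  then show ?thesis
    using w by (metis eq_id_iff lessThan_iff permutes_not_in)
qed

text \<open>A permutation carrying one strictly decreasing vector to another is increasing below
  \<open>n\<close>, hence the identity; the terms of all other permutations vanish.\<close>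

lemma lookup_antisymmetrize_strict:
  assumes keys: "keys a \<subseteq> {..<n}" "keys b \<subseteq> {..<n}"
    and a: "\<And>i j. i < j \<Longrightarrow> j < n \<Longrightarrow> lookup a i > lookup a j"
    and b: "\<And>i j. i < j \<Longrightarrow> j < n \<Longrightarrow> lookup b i > lookup b j"
  shows "lookup (antisymmetrize n (monomial b)) a = (if a = b then 1 else 0)"
proof -
  let ?t = "\<lambda>w. sign w * lookup (monomial b) (Poly_Mapping.map_key w a)"
  have "?t w = 0" if w: "w permutes {..<n}" and "w \<noteq> id" for w
  proof -
    have "Poly_Mapping.map_key w a \<noteq> b"
    proof
      assume eq: "Poly_Mapping.map_key w a = b"
      have "w i < w j" if "i < j" "j < n" for i j
      proof (rule ccontr)
        assume "\<not> w i < w j"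
        moreover have "w i \<noteq> w j" using permutes_inj[OF w] that by (metis injD less_irrefl)
        moreover have "w i < n" using w that permutes_in_image[OF w, of i] by simp
        ultimately have "lookup a (w j) > lookup a (w i)" using a[of "w j" "w i"] by simp
        with b[OF that] show False
          by (simp flip: eq add: lookup_map_key[OF permutes_inj[OF w]])
      qed
      then show False using strict_mono_permutation_eq_id[OF w] \<open>w \<noteq> id\<close> by blast
    qed
    then show ?thesis by (simp add: lookup_monomial)
  qed
  then have "lookup (antisymmetrize n (monomial b)) a = (\<Sum>w\<in>{id}. ?t w)"
    unfolding lookup_antisymmetrize
    by (intro sum.mono_neutral_right) (auto simp: finite_permutations permutes_id)
  moreover have "Poly_Mapping.map_key id a = a" by (simp add: id_def map_key_id)
  ultimately show ?thesis by (simp add: lookup_monomial)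
qed

lemma antisymmetrize_rho_nonzero: "antisymmetrize n (xpow (rho n)) \<noteq> 0"
proof -
  have "lookup (antisymmetrize n (xpow (rho n))) (rho_exp n) = 1"
    unfolding xpow_def by (subst lookup_antisymmetrize_strict)
      (auto simp: keys_rho lookup_rho simp del: lookup_nth keys_nth)
  then show ?thesis by force
qed

lemma weyl_pi_eq:
  "antisymmetrize n (xpow (rho n)) * g = antisymmetrize n (xpow (rho n) * f) \<Longrightarrow> weyl_pi n f = g"
  unfolding weyl_pi_def
  by (rule the_equality) (assumption, metis mult_left_cancel antisymmetrize_rho_nonzero)

abbreviation in_vars :: "nat \<Rightarrow> laurent \<Rightarrow> bool" where
  "in_vars n \<equiv> supported (\<lambda>a. keys a \<subseteq> {..<n})"

lemma in_vars_mult: "in_vars n f \<Longrightarrow> in_vars n g \<Longrightarrow> in_vars n (f * g)"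
  by (erule (1) supported_mult) (rule keys_add_subset)

lemma in_vars_rho: "in_vars n (xpow (rho n))"
  by (simp add: xpow_def keys_rho del: keys_nth)

text \<open>
  Multiplication by a power of \<open>x\<^sub>1 \<cdots> x\<^sub>n\<close>, which commutes with antisymmetrization, reduces the
  divisibility to nonnegative exponents.
\<close>

lemma antisymmetrize_rho_dvd:
  assumes "in_vars n F"
  shows "antisymmetrize n (xpow (rho n)) dvd antisymmetrize n F"
  using assms
proof (induction rule: laurent_induction)
  case (one b)
  define N where "N = (\<Sum>i<n. \<bar>lookup b i\<bar>)"
  \<comment> \<open>Adding the Weyl vector to \<open>c\<close> returns \<open>b\<close> raised by
    \<open>N\<close> in every entry, which is nonnegative by the choice of \<open>N\<close>.\<close>
  define c where "c i = lookup b i + N - (int n - 1 - int i)" for i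
  have N: "0 \<le> lookup b i + N" if "i < n" for i
  proof -
    have "\<bar>lookup b i\<bar> \<le> N"
      unfolding N_def using that by (intro member_le_sum) auto
    then show ?thesis by simp
  qed
  let ?e = "\<lambda>N. expo 0 n (\<lambda>_. N)"
  have inv: "Poly_Mapping.map_key w (?e N) = ?e N" if "w permutes {..<n}" for w N
    using that permutes_in_image[OF that]
    by (intro poly_mapping_eqI) (simp add: lookup_map_key permutes_inj lookup_expo)
  have "?e (- N) + expo 0 n (\<lambda>i. c i + (int n - 1 - int i)) = b"
    unfolding expo_add using one by (intro expo_eqI[symmetric]) (simp_all add: c_def)
  then have "antisymmetrize n (monomial b) =
      antisymmetrize n (monomial (?e (- N)) * monomial (expo 0 n (\<lambda>i. c i + (int n - 1 - int i))))"
    by (simp flip: monomial_add)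
  also have "\<dots> = monomial (?e (- N)) * (antisymmetrize n (xpow (rho n)) * hom_det n n c)"
  proof -
    have "0 \<le> c i + (int n - 1 - int i)" if "i < n" for i
      using N[OF that] by (simp add: c_def)
    then show ?thesis
      by (simp only: antisymmetrize_shift[OF inv] antisymmetrize_eq_hom_det)
  qed
  finally show ?case by simp
qed (auto simp: antisymmetrize_diff)

lemma weyl_pi_spec:
  assumes "in_vars n f"
  shows "antisymmetrize n (xpow (rho n)) * weyl_pi n f = antisymmetrize n (xpow (rho n) * f)"
proof -
  obtain g where "antisymmetrize n (xpow (rho n) * f) = antisymmetrize n (xpow (rho n)) * g"
    using antisymmetrize_rho_dvd[OF in_vars_mult[OF in_vars_rho assms]] by (elim dvdE)
  then show ?thesis using weyl_pi_eq by metis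
qed

text \<open>The bialternant formula: divisibility turns the definite description in
  \<open>weyl_pi\<close> into an equation.\<close>

lemma schur_spec:
  assumes "length \<mu> \<le> n"
  shows "antisymmetrize n (xpow (rho n)) * schur n \<mu> =
    antisymmetrize n (monomial (Poly_Mapping.nth \<mu> + rho_exp n))"
  using weyl_pi_spec[of n "xpow \<mu>"] keys_nth_subset[OF assms]
  by (simp add: schur_def xpow_def monomial_add mult.commute del: keys_nth)

subsection \<open>Schur expansions\<close>

lemma frag_extend_mult: "h * frag_extend f c = frag_extend (\<lambda>\<mu>. h * f \<mu> :: laurent) c"
  by (simp add: frag_extend_def sum_distrib_left frag_cmul_mult_right)

lemma lookup_frag_extend:
  "lookup (frag_extend f c) a = (\<Sum>\<mu>\<in>keys c. lookup c \<mu> * lookup (f \<mu>) a)"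
  by (simp add: frag_extend_def lookup_sum)

text \<open>\<open>J(x^b)\<close> vanishes if two exponents coincide. Otherwise sorting them changes
  it only by a sign, and a strictly decreasing vector is a dominant weight plus
  \<open>\<rho>\<close>.\<close>

lemma antisymmetrize_expansion:
  assumes "in_vars n F"
  obtains c where "keys c \<subseteq> dominant_weights n"
    "antisymmetrize n F =
      frag_extend (\<lambda>\<mu>. antisymmetrize n (monomial (Poly_Mapping.nth \<mu> + rho_exp n))) c"
proof -
  let ?J = "\<lambda>\<mu>. antisymmetrize n (monomial (Poly_Mapping.nth \<mu> + rho_exp n))"
  have "\<exists>c. keys c \<subseteq> dominant_weights n \<and> antisymmetrize n F = frag_extend ?J c"
    using assms
  proof (induction rule: laurent_induction)
    case zero
    then show ?case by (intro exI[of _ 0]) simp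
  next
    case (diff f g)
    then obtain c d where "keys c \<subseteq> dominant_weights n" "antisymmetrize n f = frag_extend ?J c"
      "keys d \<subseteq> dominant_weights n" "antisymmetrize n g = frag_extend ?J d" by blast
    then show ?case
      using keys_diff[of c d]
      by (intro exI[of _ "c - d"]) (auto simp: antisymmetrize_diff frag_extend_diff)
  next
    case (one b)
    show ?case
    proof (cases "\<exists>i j. i < n \<and> j < n \<and> i \<noteq> j \<and> lookup b i = lookup b j")
      case True
      then show ?thesis
        using antisymmetrize_monomial_eq_0 by (intro exI[of _ 0]) auto
    next
      case False
      define xs where "xs = map (lookup b) [0..<n]"
      define ys where "ys = rev (sort xs)"
      define \<mu> where "\<mu> = map (\<lambda>i. ys ! i - (int n - 1 - int i)) [0..<n]"
      have "distinct xs" using False by (auto simp: xs_def distinct_map intro!: inj_onI) metis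
      then have ys: "sorted_wrt (>) ys"
        by (simp add: ys_def sorted_wrt_rev strict_sorted_iff)
      have [simp]: "length ys = n" by (simp add: ys_def xs_def)
      have "mset xs = mset ys" by (simp add: ys_def)
      then obtain p where p: "p permutes {..<length xs}" "permute_list p xs = ys"
        using mset_eq_permutation[of ys xs] by auto
      then have p': "p permutes {..<n}" by (simp add: xs_def)
      have ys_nth: "ys ! i = lookup b (p i)" if "i < n" for i
        using that p permutes_in_image[OF p', of i] by (auto simp: permute_list_nth xs_def)
      \<comment> \<open>Strictly decreasing integers drop by at least 1 per step, so subtracting
        \<open>\<rho>\<close> leaves a weakly decreasing \<open>\<mu>\<close>.\<close>
      have ys_less: "ys ! j + int (j - i) \<le> ys ! i" if "i \<le> j" "j < n" for i j
        using that
      proof (induction j rule: dec_induct)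
        case (step j)
        with sorted_wrt_nth_less[OF ys, of j "Suc j"] show ?case by (simp add: Suc_diff_le)
      qed simp
      have "\<mu> \<in> dominant_weights n"
        unfolding dominant_weights_def
        using ys_less by (auto simp: sorted_wrt_iff_nth_less \<mu>_def) (smt (verit) less_imp_le_nat of_nat_diff)
      moreover have "Poly_Mapping.map_key p b = Poly_Mapping.nth \<mu> + rho_exp n"
      proof (rule poly_mapping_eqI)
        fix i
        show "lookup (Poly_Mapping.map_key p b) i = lookup (Poly_Mapping.nth \<mu> + rho_exp n) i"
        proof (cases "i < n")
          case True
          then show ?thesis
            by (simp add: lookup_map_key permutes_inj[OF p'] lookup_add lookup_nth_list rho_nth
                ys_nth \<mu>_def del: lookup_nth)
        next
          case False
          then have "p i \<notin> keys b" using p' one permutes_in_image[OF p', of i] by auto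
          with False show ?thesis
            by (simp add: lookup_map_key permutes_inj[OF p'] lookup_add lookup_nth_list
                \<mu>_def in_keys_iff del: lookup_nth)
        qed
      qed
      then have "?J \<mu> = of_int (sign p) * antisymmetrize n (monomial b)"
        using antisymmetrize_monomial_permuted[OF p', of b] by simp
      then have "antisymmetrize n (monomial b) = frag_cmul (sign p) (?J \<mu>)"
        by (simp add: of_int_mult_eq_frag_cmul sign_idempotent)
      then have "antisymmetrize n (monomial b) = frag_extend ?J (frag_cmul (sign p) (frag_of \<mu>))"
        by (simp add: frag_extend_cmul)
      ultimately show ?thesis
        using keys_cmul[of "sign p" "frag_of \<mu>"] by (intro exI conjI) auto
    qed
  qed
  then show ?thesis using that by blast
qed

lemma dominant_plus_rho:
  assumes "\<mu> \<in> dominant_weights n"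
  shows "keys (Poly_Mapping.nth \<mu> + rho_exp n) \<subseteq> {..<n}"
    "i < j \<Longrightarrow> j < n \<Longrightarrow>
      lookup (Poly_Mapping.nth \<mu> + rho_exp n) i > lookup (Poly_Mapping.nth \<mu> + rho_exp n) j"
proof -
  show "keys (Poly_Mapping.nth \<mu> + rho_exp n) \<subseteq> {..<n}"
    using assms by (intro keys_add_subset keys_nth_subset) (simp_all add: dominant_weights_def)
  assume "i < j" "j < n"
  moreover from this have "\<mu> ! j \<le> \<mu> ! i"
    using assms by (auto simp: dominant_weights_def sorted_wrt_iff_nth_less)
  ultimately show "lookup (Poly_Mapping.nth \<mu> + rho_exp n) i > lookup (Poly_Mapping.nth \<mu> + rho_exp n) j"
    using assms by (simp add: lookup_add lookup_nth_list rho_nth dominant_weights_def del: lookup_nth)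
qed

lemma nth_eq_imp_list_eq:
  assumes "Poly_Mapping.nth \<mu> = (Poly_Mapping.nth \<nu> :: nat \<Rightarrow>\<^sub>0 int)" "length \<mu> = length \<nu>"
  shows "\<mu> = \<nu>"
proof (rule nth_equalityI)
  fix i assume "i < length \<mu>"
  then show "\<mu> ! i = \<nu> ! i"
    using assms(2) arg_cong[OF assms(1), of "\<lambda>a. lookup a i"] by (simp add: lookup_nth_list del: lookup_nth)
qed (fact assms(2))

lemma lookup_antisymmetrize_dominant:
  assumes "\<mu> \<in> dominant_weights n" "\<nu> \<in> dominant_weights n"
  shows "lookup (antisymmetrize n (monomial (Poly_Mapping.nth \<mu> + rho_exp n)))
      (Poly_Mapping.nth \<nu> + rho_exp n) = (if \<mu> = \<nu> then 1 else 0)"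
proof -
  have "Poly_Mapping.nth \<nu> + rho_exp n = Poly_Mapping.nth \<mu> + rho_exp n \<longleftrightarrow> \<mu> = \<nu>"
    using assms nth_eq_imp_list_eq[of \<nu> \<mu>] by (auto simp: dominant_weights_def)
  with assms show ?thesis
    by (subst lookup_antisymmetrize_strict) (simp_all add: dominant_plus_rho)
qed

text \<open>Giving \<open>g\<close> through the numerator \<open>J(F)\<close> lets one result serve
  Schur polynomials, \<open>weyl_pi\<close> and \<open>hom_map\<close>. Coefficients are read off at
  \<open>x^(\<nu> + \<rho>)\<close>, which occurs in \<open>J(x^(\<mu> + \<rho>))\<close> for
  dominant \<open>\<mu>\<close> only if \<open>\<mu> = \<nu>\<close>; this also makes the expansion
  unique.\<close>

lemma schur_expansion_props:
  assumes F: "in_vars n F" and eq: "antisymmetrize n (xpow (rho n)) * g = antisymmetrize n F"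
  shows "keys (schur_expansion n g) \<subseteq> dominant_weights n"
    and "\<nu> \<in> dominant_weights n \<Longrightarrow> lookup (schur_expansion n g) \<nu> =
      lookup (antisymmetrize n F) (Poly_Mapping.nth \<nu> + rho_exp n)"
proof -
  let ?J = "\<lambda>\<mu>. antisymmetrize n (monomial (Poly_Mapping.nth \<mu> + rho_exp n))"
  let ?P = "\<lambda>c. keys c \<subseteq> dominant_weights n \<and>
            g = (\<Sum>\<mu>\<in>keys c. of_int (lookup c \<mu>) * schur n \<mu>)"
  have mult: "antisymmetrize n (xpow (rho n)) * frag_extend (schur n) c = frag_extend ?J c"
    if "keys c \<subseteq> dominant_weights n" for c
    unfolding frag_extend_mult
    using that by (intro frag_extend_eq schur_spec) (auto simp: dominant_weights_def)
  have P_iff: "?P c \<longleftrightarrow> keys c \<subseteq> dominant_weights n \<and> g = frag_extend (schur n) c" for c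
    by (simp add: frag_extend_def of_int_mult_eq_frag_cmul)
  have lookup_P: "lookup c \<nu> = lookup (antisymmetrize n F) (Poly_Mapping.nth \<nu> + rho_exp n)"
    if c: "?P c" and \<nu>: "\<nu> \<in> dominant_weights n" for c \<nu>
  proof -
    have "lookup (frag_extend ?J c) (Poly_Mapping.nth \<nu> + rho_exp n) =
      (\<Sum>\<mu>\<in>keys c. if \<mu> = \<nu> then lookup c \<nu> else 0)"
      unfolding lookup_frag_extend using c \<nu>
      by (intro sum.cong refl) (auto simp: lookup_antisymmetrize_dominant subset_iff)
    also have "\<dots> = lookup c \<nu>" by (simp add: in_keys_iff)
    finally show ?thesis using c mult[of c] unfolding P_iff by (simp flip: eq)
  qed
  obtain c where "keys c \<subseteq> dominant_weights n" "antisymmetrize n F = frag_extend ?J c"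
    using antisymmetrize_expansion[OF F] by blast
  then have "antisymmetrize n (xpow (rho n)) * g =
      antisymmetrize n (xpow (rho n)) * frag_extend (schur n) c"
    by (simp add: eq mult)
  then have c: "?P c"
    unfolding P_iff using \<open>keys c \<subseteq> dominant_weights n\<close> antisymmetrize_rho_nonzero by simp
  have "d = c" if "?P d" for d
  proof (rule poly_mapping_eqI)
    fix \<mu> show "lookup d \<mu> = lookup c \<mu>"
    proof (cases "\<mu> \<in> dominant_weights n")
      case True
      then show ?thesis using lookup_P[OF c] lookup_P[OF that] by simp
    next
      case False
      then have "\<mu> \<notin> keys c" "\<mu> \<notin> keys d" using c that by blast+
      then show ?thesis by (simp add: in_keys_iff)
    qed
  qed
  then have "schur_expansion n g = c"
    unfolding schur_expansion_def using c by (intro the_equality) blast+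
  with c lookup_P[OF c] show "keys (schur_expansion n g) \<subseteq> dominant_weights n"
    and "\<nu> \<in> dominant_weights n \<Longrightarrow> lookup (schur_expansion n g) \<nu> =
      lookup (antisymmetrize n F) (Poly_Mapping.nth \<nu> + rho_exp n)" by simp_all
qed

lemma schur_expansion_schur:
  assumes "\<mu> \<in> dominant_weights n"
  shows "schur_expansion n (schur n \<mu>) = frag_of \<mu>"
proof (rule poly_mapping_eqI)
  fix \<nu>
  have spec: "antisymmetrize n (xpow (rho n)) * schur n \<mu> =
      antisymmetrize n (monomial (Poly_Mapping.nth \<mu> + rho_exp n))"
    using assms by (intro schur_spec) (simp add: dominant_weights_def)
  have in_vars: "in_vars n (monomial (Poly_Mapping.nth \<mu> + rho_exp n))"
    using dominant_plus_rho(1)[OF assms] by simp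
  show "lookup (schur_expansion n (schur n \<mu>)) \<nu> = lookup (frag_of \<mu>) \<nu>"
  proof (cases "\<nu> \<in> dominant_weights n")
    case True
    with schur_expansion_props(2)[OF in_vars spec True] assms show ?thesis
      by (simp add: lookup_antisymmetrize_dominant)
  next
    case False
    with schur_expansion_props(1)[OF in_vars spec] assms show ?thesis
      by (auto simp: subset_iff in_keys_iff)
  qed
qed

lemma hall_inner_schur:
  "\<mu> \<in> dominant_weights n \<Longrightarrow> hall_inner n (schur n \<mu>) g = lookup (schur_expansion n g) \<mu>"
  by (simp add: hall_inner_def schur_expansion_schur)

subsection \<open>The substitution of complete homogeneous polynomials for monomials\<close>

text \<open>The map \<open>\<Phi>\<close> of the introduction. It is linear but in general not
  multiplicative.\<close>

definition hom_map :: "nat \<Rightarrow> laurent \<Rightarrow> laurent" where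
  "hom_map n = frag_extend (\<lambda>a. \<Prod>i<n. complete_hom n (lookup a i))"

lemma hom_map_0 [simp]: "hom_map n 0 = 0"
  by (simp add: hom_map_def)

lemma hom_map_diff: "hom_map n (f - g) = hom_map n f - hom_map n g"
  by (simp add: hom_map_def frag_extend_diff)

lemma hom_map_sum: "finite I \<Longrightarrow> hom_map n (\<Sum>i\<in>I. f i) = (\<Sum>i\<in>I. hom_map n (f i))"
  by (simp add: hom_map_def frag_extend_sum o_def)

lemma hom_map_of_int_mult: "hom_map n (of_int c * f) = of_int c * hom_map n f"
  by (simp add: hom_map_def of_int_mult_eq_frag_cmul frag_extend_cmul)

lemma hom_map_monomial: "hom_map n (monomial a) = (\<Prod>i<n. complete_hom n (lookup a i))"
  by (simp add: hom_map_def monomial_def)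

lemma hom_map_expo:
  assumes "p + m \<le> n"
  shows "hom_map n (monomial (expo p m c)) = (\<Prod>i<m. complete_hom n (c i))"
proof -
  have "hom_map n (monomial (expo p m c)) = (\<Prod>k\<in>{p..<p + m}. complete_hom n (lookup (expo p m c) k))"
    unfolding hom_map_monomial using assms
    by (intro prod.mono_neutral_right) (auto simp: lookup_expo)
  also have "\<dots> = (\<Prod>i<m. complete_hom n (c i))"
    by (rule prod.reindex_bij_witness[of _ "\<lambda>i. p + i" "\<lambda>k. k - p"]) (auto simp: lookup_expo)
  finally show ?thesis .
qed

text \<open>The denominator formula writes the argument as an alternating sum of monomials, whose
  images are the Leibniz terms of the Jacobi--Trudi determinant.\<close>

lemma hom_map_block:
  assumes "p + m \<le> n"
  shows "hom_map n (monomial (expo p m c) * block_denom p m) = hom_det n m c"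
  by (simp add: monomial_mult_block_denom hom_map_sum finite_permutations hom_map_of_int_mult
      hom_map_expo[OF assms] hom_det_def)

text \<open>No variable occurs in both factors, so at each position one of the two exponents is 0
  and contributes only \<open>h_0 = 1\<close>.\<close>

lemma hom_map_mult:
  assumes "supported (\<lambda>a. keys a \<subseteq> {..<p}) f" "supported (\<lambda>a. keys a \<subseteq> {p..}) g"
  shows "hom_map n (f * g) = hom_map n f * hom_map n g"
  using assms(1)
proof (induction rule: laurent_induction)
  case (one a)
  show ?case
    using assms(2)
  proof (induction rule: laurent_induction)
    case (one b)
    have "lookup a i = 0 \<or> lookup b i = 0" for i
    proof (rule ccontr)
      assume "\<not> ?thesis"
      then have "i \<in> keys a" "i \<in> keys b" by (simp_all add: in_keys_iff)
      then have "i \<in> {..<p}" "i \<in> {p..}" using \<open>keys a \<subseteq> {..<p}\<close> one by blast+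
      then show False by simp
    qed
    then have "complete_hom n (lookup (a + b) i) =
        complete_hom n (lookup a i) * complete_hom n (lookup b i)" for i
      by (metis add_0 add.right_neutral complete_hom_0 lookup_add mult_1 mult.right_neutral)
    then show ?case
      by (simp add: hom_map_monomial prod.distrib flip: monomial_add)
  qed (simp_all add: right_diff_distrib hom_map_diff)
qed (simp_all add: left_diff_distrib hom_map_diff)

section \<open>The Jacobi--Trudi formula for Schur polynomials\<close>

lemma hom_det_cong: "(\<And>i. i < m \<Longrightarrow> c i = d i) \<Longrightarrow> hom_det n m c = hom_det n m d"
  by (simp add: hom_det_def)

text \<open>Padding \<open>\<mu>\<close> with zeros to length \<open>n\<close> allows
  \<open>J(x^\<rho>)\<close> to be cancelled between the bialternant formula and
  \<open>antisymmetrize_eq_hom_det\<close>. Removing the padding again gives a determinant of the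
  size of a block.\<close>

lemma schur_eq_hom_det:
  assumes len: "length \<mu> \<le> n" and nonneg: "\<forall>a\<in>set \<mu>. 0 \<le> a"
  shows "schur n \<mu> = hom_det n (length \<mu>) (\<lambda>i. \<mu> ! i)"
proof -
  define c where "c i = (if i < length \<mu> then \<mu> ! i else 0)" for i
  have "Poly_Mapping.nth \<mu> + rho_exp n = expo 0 n (\<lambda>i. c i + (int n - 1 - int i))"
    using len by (intro expo_eqI keys_add_subset keys_nth_subset)
      (simp_all add: lookup_add lookup_nth_list rho_nth c_def del: lookup_nth)
  moreover have "0 \<le> c i" for i using nonneg by (simp add: c_def)
  ultimately have "antisymmetrize n (xpow (rho n)) * schur n \<mu> =
      antisymmetrize n (xpow (rho n)) * hom_det n n c"
    using schur_spec[OF len] antisymmetrize_eq_hom_det[of n c] by simp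
  then have "schur n \<mu> = hom_det n n c" using antisymmetrize_rho_nonzero by simp
  also have "\<dots> = hom_det n (length \<mu>) c"
    using len by (intro hom_det_pad) (simp_all add: c_def)
  also have "\<dots> = hom_det n (length \<mu>) (\<lambda>i. \<mu> ! i)"
    by (rule hom_det_cong) (simp add: c_def)
  finally show ?thesis .
qed

lemma polynomial_exp_0: "polynomial_exp n 0"
  by (simp add: polynomial_exp_def)

text \<open>By Jacobi--Trudi, \<open>schur n \<mu>\<close> is an integer polynomial in the
  \<open>h_k\<close>, which have no negative exponents.\<close>

lemma supported_schur:
  assumes "length \<mu> \<le> n" "\<forall>a\<in>set \<mu>. 0 \<le> a"
  shows "supported (polynomial_exp n) (schur n \<mu>)"
  unfolding schur_eq_hom_det[OF assms] hom_det_def of_int_mult_eq_frag_cmul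
  by (intro supported_sum supported_cmul supported_prod supported_complete_hom polynomial_exp_0
      polynomial_exp_add)

subsection \<open>Pairing with Schur polynomials\<close>

definition pairing :: "laurent \<Rightarrow> laurent \<Rightarrow> int" where
  "pairing s f = (\<Sum>a\<in>keys f. lookup f a * lookup s a)"

lemma pairing_eq_sum: "finite A \<Longrightarrow> keys f \<subseteq> A \<Longrightarrow> pairing s f = (\<Sum>a\<in>A. lookup f a * lookup s a)"
  unfolding pairing_def by (rule sum.mono_neutral_left) (auto simp: in_keys_iff)

lemma pairing_add: "pairing s (f + g) = pairing s f + pairing s g"
proof -
  let ?A = "keys f \<union> keys g"
  have "keys (f + g) \<subseteq> ?A" by (rule keys_add)
  then show ?thesis
    by (simp add: pairing_eq_sum[of ?A] lookup_add distrib_right sum.distrib)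
qed

lemma pairing_cmul: "pairing s (of_int c * f) = c * pairing s f"
proof -
  have "keys (of_int c * f) \<subseteq> keys f"
    by (auto simp: in_keys_iff)
  then show ?thesis
    by (simp add: pairing_eq_sum[of "keys f"] sum_distrib_left mult.assoc)
qed

lemma pairing_0 [simp]: "pairing s 0 = 0"
  by (simp add: pairing_def)

lemma pairing_diff: "pairing s (f - g) = pairing s f - pairing s g"
  using pairing_add[of s "f - g" g] by simp

lemma pairing_sum: "pairing s (\<Sum>i\<in>I. f i) = (\<Sum>i\<in>I. pairing s (f i))"
  by (induction I rule: infinite_finite_induct) (simp_all add: pairing_add)

lemma pairing_monomial [simp]: "pairing s (monomial a) = lookup s a"
  by (simp add: pairing_def monomial_def)

lemma pairing_eq_0:
  "supported P s \<Longrightarrow> supported Q f \<Longrightarrow> (\<And>a. P a \<Longrightarrow> \<not> Q a) \<Longrightarrow> pairing s f = 0"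
  unfolding pairing_def supported_def
  by (intro sum.neutral ballI) (metis mult_zero_right not_in_keys_iff_lookup_eq_zero)

text \<open>By definition \<open>permute_vars w\<close> acts on exponents through the inverse of
  \<open>w\<close>; the symmetry of the coefficients in \<open>a\<close> and \<open>b\<close>
  accounts for the change from \<open>w\<close> to its inverse.\<close>

lemma antisymmetrize_monomial:
  "antisymmetrize n (monomial b) =
    (\<Sum>w | w permutes {..<n}. of_int (sign w) * monomial (Poly_Mapping.map_key w b))"
proof (rule poly_mapping_eqI)
  fix a
  show "lookup (antisymmetrize n (monomial b)) a =
    lookup (\<Sum>w | w permutes {..<n}. of_int (sign w) * monomial (Poly_Mapping.map_key w b)) a"
    unfolding antisymmetrize_monomial_symmetric[of n b a]
    by (auto simp: lookup_antisymmetrize lookup_sum lookup_monomial intro!: sum.cong)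
qed

text \<open>For \<open>f = x^a\<close>, symmetry makes the right-hand side the coefficient of
  \<open>x^(\<rho> + a)\<close> in \<open>J(x^(\<nu> + \<rho>))\<close>, that is, in
  \<open>J(x^\<rho>)\<close> times the Schur polynomial. Expanding \<open>J(x^\<rho>)\<close> gives
  the shifts of \<open>a\<close> that occur in the denominator formula.\<close>

lemma pairing_schur_block_denom:
  assumes lam: "length \<nu> = n" and f: "in_vars n f"
  shows "pairing (schur n \<nu>) (f * block_denom 0 n) =
    lookup (antisymmetrize n (xpow (rho n) * f)) (Poly_Mapping.nth \<nu> + rho_exp n)"
  using f
proof (induction rule: laurent_induction)
  case (one a)
  let ?s = "schur n \<nu>"
  have a: "a = expo 0 n (lookup a)" using one by (intro expo_eqI) auto
  \<comment> \<open>The difference of the entries \<open>i\<close> and \<open>w i\<close> of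
    \<open>\<rho>\<close> is \<open>w i - i\<close>.\<close>
  have shift: "rho_exp n + a - Poly_Mapping.map_key w (rho_exp n) =
      expo 0 n (\<lambda>i. lookup a i - int i + int (w i))" if w: "w permutes {..<n}" for w
  proof (rule expo_eqI)
    have "w -` keys (rho_exp n) \<subseteq> {..<n}"
      using keys_rho[of n] permutes_in_image[OF w] by blast
    then show "keys (rho_exp n + a - Poly_Mapping.map_key w (rho_exp n)) \<subseteq> {..<n}"
      using one keys_rho
      by (intro keys_diff_subset keys_add_subset) (simp_all add: keys_map_key permutes_inj[OF w] del: keys_nth)
    fix i assume "i < n"
    moreover from this have "w i < n" using permutes_in_image[OF w, of i] by simp
    ultimately show "lookup (rho_exp n + a - Poly_Mapping.map_key w (rho_exp n)) i =
        lookup a i - int i + int (w i)"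
      by (simp add: lookup_add lookup_minus lookup_map_key permutes_inj[OF w] lookup_rho del: lookup_nth)
  qed
  have "lookup (antisymmetrize n (xpow (rho n) * monomial a)) (Poly_Mapping.nth \<nu> + rho_exp n) =
      lookup (antisymmetrize n (monomial (Poly_Mapping.nth \<nu> + rho_exp n))) (rho_exp n + a)"
    by (simp add: xpow_def antisymmetrize_monomial_symmetric flip: monomial_add)
  also have "\<dots> = lookup (antisymmetrize n (monomial (rho_exp n)) * ?s) (rho_exp n + a)"
    using schur_spec[of \<nu> n] lam by (simp add: xpow_def)
  also have "\<dots> = (\<Sum>w | w permutes {..<n}. sign w *
      lookup ?s (rho_exp n + a - Poly_Mapping.map_key w (rho_exp n)))"
    by (simp add: antisymmetrize_monomial sum_distrib_right lookup_sum mult.assoc lookup_monomial_mult)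
  also have "\<dots> = (\<Sum>w | w permutes {..<n}. sign w *
      lookup ?s (expo 0 n (\<lambda>i. lookup a i - int i + int (w i))))"
    by (intro sum.cong refl) (simp add: shift)
  also have "\<dots> = pairing ?s (monomial (expo 0 n (lookup a)) * block_denom 0 n)"
    by (simp add: monomial_mult_block_denom pairing_sum pairing_cmul)
  finally show ?case by (simp flip: a)
qed (simp_all add: left_diff_distrib right_diff_distrib antisymmetrize_diff pairing_diff lookup_minus)

subsection \<open>The weight filtration\<close>

text \<open>Multiplication by \<open>x_i/x_j\<close> with \<open>i < j\<close> lowers this weight by
  \<open>j - i\<close>, while polynomial exponents have nonnegative weight.\<close>

definition weight :: "nat \<Rightarrow> (nat \<Rightarrow>\<^sub>0 int) \<Rightarrow> int" where
  "weight n a = (\<Sum>i<n. int i * lookup a i)"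

lemma weight_add: "weight n (a + b) = weight n a + weight n b"
  by (simp add: weight_def lookup_add distrib_left sum.distrib)

lemma weight_0 [simp]: "weight n 0 = 0"
  by (simp add: weight_def)

lemma weight_nonneg: "(\<And>i. i < n \<Longrightarrow> 0 \<le> lookup a i) \<Longrightarrow> 0 \<le> weight n a"
  unfolding weight_def by (intro sum_nonneg) simp

definition lower :: "nat \<Rightarrow> int \<Rightarrow> (nat \<Rightarrow>\<^sub>0 int) \<Rightarrow> bool" where
  "lower n k a \<longleftrightarrow> keys a \<subseteq> {..<n} \<and> weight n a \<le> k"

lemma lower_add: "lower n k a \<Longrightarrow> lower n l b \<Longrightarrow> lower n (k + l) (a + b)"
  by (simp add: lower_def weight_add keys_add_subset add_mono)

lemma supported_lower_mult:
  "supported (lower n k) f \<Longrightarrow> supported (lower n l) g \<Longrightarrow> supported (lower n (k + l)) (f * g)"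
  by (erule (1) supported_mult) (rule lower_add)

lemma supported_lower_mono: "supported (lower n k) f \<Longrightarrow> k \<le> l \<Longrightarrow> supported (lower n l) f"
  by (erule supported_mono) (auto simp: lower_def)

lemma supported_lower_in_vars: "supported (lower n k) f \<Longrightarrow> in_vars n f"
  by (erule supported_mono) (simp add: lower_def)

lemma supported_lower_1: "0 \<le> k \<Longrightarrow> supported (lower n k) 1"
  by (simp add: lower_def)

lemma lower_root_exp: "i < j \<Longrightarrow> j < n \<Longrightarrow> lower n (- 1) (root_exp i j)"
proof -
  assume ij: "i < j" "j < n"
  have "weight n (root_exp i j) = (\<Sum>k<n. (if k = i then int i else 0) - (if k = j then int j else 0))"
    unfolding weight_def root_exp_def
    by (intro sum.cong) (auto simp: lookup_minus lookup_single when_def)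
  also have "\<dots> = int i - int j" using ij by (simp add: sum_subtractf)
  finally show ?thesis
    using ij by (auto simp: lower_def root_exp_def in_keys_iff lookup_minus lookup_single when_def
        split: if_splits)
qed

text \<open>After expansion, every term other than 1 contains at least one factor
  \<open>u \<alpha>\<close>.\<close>

lemma prod_minus_1_lower:
  assumes "finite A" "\<And>\<alpha>. \<alpha> \<in> A \<Longrightarrow> supported (lower n (- 1)) (u \<alpha>)"
  shows "supported (lower n (- 1)) ((\<Prod>\<alpha>\<in>A. 1 - u \<alpha>) - 1)"
  using assms
proof (induction A rule: finite_induct)
  case (insert \<alpha> A)
  let ?P = "\<Prod>\<alpha>\<in>A. 1 - u \<alpha>"
  have IH: "supported (lower n (- 1)) (?P - 1)" and u: "supported (lower n (- 1)) (u \<alpha>)"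
    using insert by simp_all
  have "supported (lower n (- 1)) (u \<alpha> * (?P - 1))"
    using supported_lower_mono[OF supported_lower_mult[OF u IH]] by simp
  moreover have "(\<Prod>\<alpha>\<in>insert \<alpha> A. 1 - u \<alpha>) - 1 = (?P - 1) - u \<alpha> * (?P - 1) - u \<alpha>"
    using insert(1,2) by (simp add: algebra_simps)
  ultimately show ?case
    using supported_diff[OF supported_diff[OF IH] u] by (simp only:)
qed simp

definition denom :: "(nat \<times> nat) set \<Rightarrow> laurent" where
  "denom A = (\<Prod>(i, j)\<in>A. 1 - monomial (root_exp i j))"

lemma denom_minus_1_lower:
  assumes "A \<subseteq> {(i, j). i < j \<and> j < n}"
  shows "supported (lower n (- 1)) (denom A - 1)"
proof -
  have "finite A"
    by (rule finite_subset[of _ "{..<n} \<times> {..<n}"]) (use assms in auto)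
  then have "supported (lower n (- 1)) ((\<Prod>\<alpha>\<in>A. 1 - (case \<alpha> of (i, j) \<Rightarrow> monomial (root_exp i j))) - 1)"
    by (rule prod_minus_1_lower) (use assms lower_root_exp in \<open>auto split: prod.splits\<close>)
  then show ?thesis by (simp add: denom_def case_prod_unfold)
qed

lemma supported_lower_denom:
  assumes "A \<subseteq> {(i, j). i < j \<and> j < n}"
  shows "supported (lower n 0) (denom A)"
proof -
  have "supported (lower n 0) (denom A - 1 + 1)"
    using supported_lower_mono[OF denom_minus_1_lower[OF assms], of 0] supported_lower_1[of 0 n]
    by (intro supported_add) simp_all
  then show ?thesis by simp
qed

lemma block_denom_eq: "block_denom p m = denom {(i, j). p \<le> i \<and> i < j \<and> j < p + m}"
proof -
  have "block_denom p m = (\<Prod>(j, i)\<in>(SIGMA j:{..<m}. {..<j}). 1 - monomial (root_exp (p + i) (p + j)))"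
    unfolding block_denom_def by (rule prod.Sigma) auto
  also have "\<dots> = denom {(i, j). p \<le> i \<and> i < j \<and> j < p + m}"
    unfolding denom_def
    by (rule prod.reindex_bij_witness[of _ "\<lambda>(i, j). (j - p, i - p)" "\<lambda>(j, i). (p + i, p + j)"]) auto
  finally show ?thesis .
qed

lemma supported_denom_ge:
  assumes "A \<subseteq> {(i, j). p \<le> i \<and> i < j}"
  shows "supported (\<lambda>a. keys a \<subseteq> {p..}) (denom A)"
  unfolding denom_def
proof (rule supported_prod)
  fix \<alpha> assume "\<alpha> \<in> A"
  then obtain i j where \<alpha>: "\<alpha> = (i, j)" "p \<le> i" "i < j" using assms by auto
  then have "keys (root_exp i j) \<subseteq> {p..}"
    by (auto simp: root_exp_def in_keys_iff lookup_minus lookup_single when_def split: if_splits)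
  then show "supported (\<lambda>a. keys a \<subseteq> {p..}) (case \<alpha> of (i, j) \<Rightarrow> 1 - monomial (root_exp i j))"
    using \<alpha> by (auto intro: supported_diff)
qed (simp_all add: keys_add_subset)

subsection \<open>Adjointness\<close>

text \<open>\<open>F\<close> exhibits \<open>hom_map n f\<close> as the quotient of
  \<open>J(F)\<close> by \<open>J(x^\<rho>)\<close>, so that for dominant \<open>\<nu>\<close> the
  coefficient of \<open>J(F)\<close> is that of the Schur polynomial. In this form the property is
  visibly closed under differences.\<close>

definition adjoint :: "nat \<Rightarrow> laurent \<Rightarrow> bool" where
  "adjoint n f \<longleftrightarrow> (\<exists>F. in_vars n F \<and>
     antisymmetrize n (xpow (rho n)) * hom_map n f = antisymmetrize n F \<and>
     (\<forall>\<nu>. length \<nu> = n \<longrightarrow> (\<forall>a\<in>set \<nu>. 0 \<le> a) \<longrightarrow>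
       lookup (antisymmetrize n F) (Poly_Mapping.nth \<nu> + rho_exp n) = pairing (schur n \<nu>) f))"

lemma adjoint_0: "adjoint n 0"
  unfolding adjoint_def by (rule exI[of _ 0]) simp

lemma adjoint_diff:
  assumes "adjoint n f" "adjoint n g"
  shows "adjoint n (f - g)"
proof -
  obtain F G where "in_vars n F" "antisymmetrize n (xpow (rho n)) * hom_map n f = antisymmetrize n F"
    "\<forall>\<nu>. length \<nu> = n \<longrightarrow> (\<forall>a\<in>set \<nu>. 0 \<le> a) \<longrightarrow>
       lookup (antisymmetrize n F) (Poly_Mapping.nth \<nu> + rho_exp n) = pairing (schur n \<nu>) f"
    "in_vars n G" "antisymmetrize n (xpow (rho n)) * hom_map n g = antisymmetrize n G"
    "\<forall>\<nu>. length \<nu> = n \<longrightarrow> (\<forall>a\<in>set \<nu>. 0 \<le> a) \<longrightarrow>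
       lookup (antisymmetrize n G) (Poly_Mapping.nth \<nu> + rho_exp n) = pairing (schur n \<nu>) g"
    using assms unfolding adjoint_def by blast
  then show ?thesis
    unfolding adjoint_def
    by (intro exI[of _ "F - G"])
      (simp add: supported_diff hom_map_diff antisymmetrize_diff right_diff_distrib lookup_minus pairing_diff)
qed

text \<open>Both sides vanish: \<open>h\<close> of a negative index is 0, and the Schur polynomials
  of nonnegative \<open>\<nu>\<close> have no negative exponents.\<close>

lemma adjoint_monomial_neg:
  assumes "i < n" "lookup a i < 0"
  shows "adjoint n (monomial a)"
proof -
  have "hom_map n (monomial a) = 0"
    unfolding hom_map_monomial
    by (intro prod_zero bexI[of _ i]) (use assms in \<open>simp_all add: complete_hom_neg\<close>)
  moreover have "lookup (schur n \<nu>) a = 0" if "length \<nu> = n" "\<forall>b\<in>set \<nu>. 0 \<le> b" for \<nu>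
  proof (rule ccontr)
    assume "lookup (schur n \<nu>) a \<noteq> 0"
    then have "polynomial_exp n a" using supportedD[OF supported_schur[of \<nu> n]] that by simp
    with assms(2) show False by (auto simp: polynomial_exp_def not_le[symmetric])
  qed
  ultimately show ?thesis
    unfolding adjoint_def by (intro exI[of _ 0]) simp
qed

text \<open>Take \<open>F = x^(\<rho> + a)\<close>: Jacobi--Trudi gives the quotient, and
  \<open>pairing_schur_block_denom\<close> gives the coefficients.\<close>

lemma adjoint_block:
  assumes "keys a \<subseteq> {..<n}" "\<And>i. i < n \<Longrightarrow> 0 \<le> lookup a i"
  shows "adjoint n (monomial a * block_denom 0 n)"
proof -
  have a: "a = expo 0 n (lookup a)" using assms(1) by (intro expo_eqI) auto
  have "rho_exp n + a = expo 0 n (\<lambda>i. lookup a i + (int n - 1 - int i))"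
    using assms(1) keys_rho by (intro expo_eqI keys_add_subset) (simp_all add: lookup_add lookup_rho del: lookup_nth keys_nth)
  then have "antisymmetrize n (xpow (rho n)) * hom_map n (monomial a * block_denom 0 n) =
      antisymmetrize n (xpow (rho n) * monomial a)"
    using antisymmetrize_eq_hom_det[of n "lookup a"] hom_map_block[of 0 n n "lookup a"] assms(2) a
    by (simp add: xpow_def flip: monomial_add)
  then show ?thesis
    unfolding adjoint_def using assms(1)
    by (intro exI[of _ "xpow (rho n) * monomial a"])
      (simp add: in_vars_mult in_vars_rho pairing_schur_block_denom)
qed

text \<open>
  Both sides of the adjointness are known on \<open>x\<^sup>a \<Prod>\<^bsub>i<j\<^esub> (1 - x\<^sub>i/x\<^sub>j)\<close>, which differs from \<open>x\<^sup>a\<close>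
  by monomials of smaller weight; the weight is bounded below on polynomial exponents, and the
  other exponents contribute zero to both sides.
\<close>

lemma adjoint_monomial:
  assumes "keys a \<subseteq> {..<n}"
  shows "adjoint n (monomial a)"
  using assms
proof (induction "nat (weight n a)" arbitrary: a rule: less_induct)
  case less
  show ?case
  proof (cases "\<exists>i<n. lookup a i < 0")
    case True
    then show ?thesis using adjoint_monomial_neg by blast
  next
    case False
    then have nonneg: "0 \<le> lookup a i" if "i < n" for i using that by (meson not_le)
    have weight: "0 \<le> weight n a" using nonneg by (rule weight_nonneg)
    have "supported (lower n (weight n a)) (monomial a)"
      using less.prems by (simp add: lower_def)
    moreover have "supported (lower n (- 1)) (block_denom 0 n - 1)"
      unfolding block_denom_eq by (rule denom_minus_1_lower) auto
    ultimately have "supported (lower n (weight n a - 1)) (monomial a * (block_denom 0 n - 1))"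
      using supported_lower_mult by fastforce
    then have "adjoint n (monomial a * (block_denom 0 n - 1))"
    proof (induction rule: laurent_induction)
      case (one b)
      show ?case
      proof (cases "\<exists>i<n. lookup b i < 0")
        case True
        then show ?thesis using adjoint_monomial_neg by blast
      next
        case False
        \<comment> \<open>Nonnegativity makes the bound \<open>weight n a - 1\<close> a strict
          decrease of the natural number on which the induction runs.\<close>
        then have "0 \<le> weight n b" by (intro weight_nonneg) (meson not_less)
        with one show ?thesis by (intro less.hyps) (auto simp: lower_def)
      qed
    qed (auto intro: adjoint_0 adjoint_diff)
    moreover have "adjoint n (monomial a * block_denom 0 n)"
      using less.prems nonneg by (rule adjoint_block)
    moreover have "monomial a = monomial a * block_denom 0 n - monomial a * (block_denom 0 n - 1)"
      by (simp add: algebra_simps)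
    ultimately show ?thesis using adjoint_diff by metis
  qed
qed

lemma adjoint_in_vars: "in_vars n f \<Longrightarrow> adjoint n f"
  by (induction rule: laurent_induction) (auto intro: adjoint_0 adjoint_diff adjoint_monomial)

subsection \<open>Summation over the powers of \<open>q\<close>\<close>

lemma geom_prod_lower:
  assumes "finite A" "\<And>\<alpha>. \<alpha> \<in> A \<Longrightarrow> supported (lower n (- 1)) (u \<alpha>)"
  shows "supported (lower n (- int k)) (fps_nth (geom_prod A u) k)"
  using assms(1)
proof (rule geom_prod_nth_induct[where P = "\<lambda>k. supported (lower n (- int k))"])
  fix k \<alpha> f assume "\<alpha> \<in> A" "supported (lower n (- int k)) f"
  then show "supported (lower n (- int (Suc k))) (u \<alpha> * f)"
    using supported_lower_mult[OF assms(2), of \<alpha> "- int k" f] by simp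
qed (simp_all add: lower_def supported_add)

text \<open>At \<open>q = 1\<close> the full series need not be a Laurent polynomial, but its
  truncation inverts the product up to terms of very low weight. Multiplication by one factor
  telescopes, leaving the previous truncated sum minus \<open>u \<alpha>\<close> times the last
  coefficient.\<close>

lemma prod_mult_partial_sum_geom_prod:
  assumes "finite A" "\<And>\<alpha>. \<alpha> \<in> A \<Longrightarrow> supported (lower n (- 1)) (u \<alpha>)"
  shows "supported (lower n (- 1 - int N))
    ((\<Prod>\<alpha>\<in>A. 1 - u \<alpha>) * (\<Sum>k\<le>N. fps_nth (geom_prod A u) k) - 1)"
  using assms
proof (induction A rule: finite_induct)
  case empty
  have "(\<Sum>k\<le>N. fps_nth (1 :: laurent fps) k) = 1" by simp
  then show ?case by (simp add: geom_prod_empty)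
next
  case (insert \<alpha> A)
  let ?G = "\<lambda>k. fps_nth (geom_prod A u) k" and ?G' = "\<lambda>k. fps_nth (geom_prod (insert \<alpha> A) u) k"
  let ?E = "\<Prod>\<alpha>\<in>A. 1 - u \<alpha>"
  have tele: "(1 - u \<alpha>) * (\<Sum>k\<le>N. ?G' k) = (\<Sum>k\<le>N. ?G k) - u \<alpha> * ?G' N"
  proof (induction N)
    case 0
    then show ?case using insert(1) by (simp add: geom_prod_nth_0)
  next
    case (Suc N)
    show ?case
      unfolding sum.atMost_Suc distrib_left Suc.IH
      using geom_prod_insert_nth_Suc[OF insert(1,2), of u N] by (simp add: left_diff_distrib)
  qed
  have "supported (lower n (- 1)) (?E - 1)"
    using insert by (intro prod_minus_1_lower) auto
  then have "supported (lower n 0) (?E - 1 + 1)"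
    by (intro supported_add supported_lower_1) (auto elim: supported_lower_mono)
  then have E: "supported (lower n 0) ?E" by simp
  have u: "supported (lower n (- 1)) (u \<alpha>)" using insert by simp
  have G': "supported (lower n (- int N)) (?G' N)"
    by (rule geom_prod_lower) (use insert in auto)
  have "supported (lower n (- 1 - int N)) (?E * (u \<alpha> * ?G' N))"
    using supported_lower_mult[OF E supported_lower_mult[OF u G']] by simp
  moreover have "supported (lower n (- 1 - int N)) (?E * (\<Sum>k\<le>N. ?G k) - 1)"
    using insert by simp
  moreover have "(\<Prod>\<alpha>\<in>insert \<alpha> A. 1 - u \<alpha>) * (\<Sum>k\<le>N. ?G' k) = ?E * ((1 - u \<alpha>) * (\<Sum>k\<le>N. ?G' k))"
    using insert(1,2) by (simp add: ac_simps)
  moreover have "?E * ((1 - u \<alpha>) * (\<Sum>k\<le>N. ?G' k)) - 1 =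
      (?E * (\<Sum>k\<le>N. ?G k) - 1) - ?E * (u \<alpha> * ?G' N)"
    unfolding tele by (simp add: right_diff_distrib)
  ultimately show ?case
    by (simp only: supported_diff)
qed

lemma B_series_eq: "B_series \<eta> = geom_prod (Roots \<eta>) (\<lambda>(i, j). monomial (root_exp i j))"
  unfolding B_series_def geom_prod_def root_factor_def root_exp_def
  by (intro prod.cong) auto

section \<open>Block boundaries and roots\<close>

lemma sum_list_take_mono: "i \<le> j \<Longrightarrow> sum_list (take i \<eta>) \<le> sum_list (take j (\<eta> :: nat list))"
proof -
  assume "i \<le> j"
  then have "take j \<eta> = take i \<eta> @ take (j - i) (drop i \<eta>)"
    by (metis le_add_diff_inverse take_add)
  then show ?thesis by simp
qed

lemma sum_list_take_le: "sum_list (take i \<eta>) \<le> sum_list (\<eta> :: nat list)"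
  using sum_list_take_mono[of i "max i (length \<eta>)" \<eta>] by simp

lemma Roots_subset: "Roots \<eta> \<subseteq> {(i, j). i < j \<and> j < sum_list \<eta>}"
  by (auto simp: Roots_def)

section \<open>Both sides as a pairing, for fixed block sizes and weights\<close>

context
  fixes \<eta> :: "nat list" and \<gamma> \<nu> :: "int list" and n :: nat
  assumes sum_\<eta>: "sum_list \<eta> = n" and len_\<gamma>: "length \<gamma> = n"
    and len_\<nu>: "length \<nu> = n" and part_\<nu>: "is_partition \<nu>"
begin

text \<open>For a block boundary \<open>p\<close> these are the pairs within one block among the
  first \<open>p\<close> variables, the positive roots of the Levi subgroup; varying
  \<open>p\<close> permits induction over the blocks.\<close>

definition levi :: "nat \<Rightarrow> (nat \<times> nat) set" where
  "levi p = {(i, j). i < j \<and> j < p} - Roots \<eta>"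

lemma \<nu>_dominant: "\<nu> \<in> dominant_weights n"
  using len_\<nu> part_\<nu> by (simp add: dominant_weights_def is_partition_def)

lemma \<nu>_nonneg: "\<forall>a\<in>set \<nu>. 0 \<le> a"
  using part_\<nu> by (simp add: is_partition_def)

lemma denom_split: "block_denom 0 n = denom (levi n) * denom (Roots \<eta>)"
proof -
  have "levi n \<union> Roots \<eta> = {(i, j). 0 \<le> i \<and> i < j \<and> j < 0 + n}"
    using Roots_subset[of \<eta>] sum_\<eta> by (auto simp: levi_def)
  moreover have "finite (levi n)"
    by (rule finite_subset[of _ "{..<n} \<times> {..<n}"]) (auto simp: levi_def)
  ultimately show ?thesis
    unfolding block_denom_eq denom_def
    by (subst prod.union_disjoint[symmetric]) (auto simp: levi_def finite_Roots)
qed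

lemma in_vars_xpow: "in_vars n (xpow \<gamma>)"
  using len_\<gamma> keys_nth_subset[of \<gamma> n] by (simp add: xpow_def del: keys_nth)

lemma B_lower: "supported (lower n (- int k)) (fps_nth (B_series \<eta>) k)"
  unfolding B_series_eq
  by (rule geom_prod_lower) (use lower_root_exp Roots_subset[of \<eta>] sum_\<eta> finite_Roots in \<open>auto\<close>)

lemma K_coeff:
  "lookup (schur_expansion n (fps_nth (H_series \<eta> \<gamma>) k)) \<nu> =
    pairing (schur n \<nu>) (xpow \<gamma> * fps_nth (B_series \<eta>) k * block_denom 0 n)"
proof -
  let ?f = "xpow \<gamma> * fps_nth (B_series \<eta>) k"
  have f: "in_vars n ?f"
    by (intro in_vars_mult in_vars_xpow supported_lower_in_vars[OF B_lower])
  have "lookup (schur_expansion n (weyl_pi n ?f)) \<nu> =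
      lookup (antisymmetrize n (xpow (rho n) * ?f)) (Poly_Mapping.nth \<nu> + rho_exp n)"
    by (rule schur_expansion_props(2)[OF in_vars_mult[OF in_vars_rho f] weyl_pi_spec[OF f] \<nu>_dominant])
  then show ?thesis
    by (simp add: H_series_def sum_\<eta> pairing_schur_block_denom[OF len_\<nu> f])
qed

text \<open>For \<open>N\<close> at least the weight of \<open>\<gamma>\<close>, the error of the
  truncated series has negative weight even after multiplication by
  \<open>xpow \<gamma> * denom (levi n)\<close>, whereas \<open>schur n \<nu>\<close> contains only
  exponents of nonnegative weight. The partial sums are therefore constant from there on.\<close>

lemma K_poly_at_1:
  "poly (K_poly \<eta> \<gamma> \<nu>) 1 = pairing (schur n \<nu>) (xpow \<gamma> * denom (levi n))"
proof -
  define K where "K k = lookup (schur_expansion n (fps_nth (H_series \<eta> \<gamma>) k)) \<nu>" for k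
  define g where "g = Poly_Mapping.nth \<gamma>"
  let ?s = "schur n \<nu>"
  have partial_sum: "(\<Sum>k\<le>N. K k) = pairing ?s (xpow \<gamma> * denom (levi n))" if N: "weight n g \<le> int N" for N
  proof -
    let ?R = "denom (Roots \<eta>) * (\<Sum>k\<le>N. fps_nth (B_series \<eta>) k) - 1"
    have R: "supported (lower n (- 1 - int N)) ?R"
    proof -
      let ?u = "\<lambda>\<alpha>. monomial (root_exp (fst \<alpha>) (snd \<alpha>))"
      have "supported (lower n (- 1)) (?u \<alpha>)" if "\<alpha> \<in> Roots \<eta>" for \<alpha>
        using that Roots_subset[of \<eta>] sum_\<eta> by (auto intro!: lower_root_exp)
      then show ?thesis
        using prod_mult_partial_sum_geom_prod[OF finite_Roots, of \<eta> n ?u N]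
        by (simp only: B_series_eq denom_def case_prod_unfold)
    qed
    have "supported (lower n (weight n g)) (xpow \<gamma>)"
      using keys_nth_subset[of \<gamma> n] len_\<gamma> by (simp add: xpow_def lower_def g_def del: keys_nth)
    moreover have "supported (lower n 0) (denom (levi n))"
      by (rule supported_lower_denom) (auto simp: levi_def)
    ultimately have "supported (lower n (weight n g + 0 + (- 1 - int N))) (xpow \<gamma> * denom (levi n) * ?R)"
      by (intro supported_lower_mult R)
    then have low: "supported (lower n (- 1)) (xpow \<gamma> * denom (levi n) * ?R)"
      using N by (elim supported_lower_mono) simp
    have "pairing ?s (xpow \<gamma> * denom (levi n) * ?R) = 0"
    proof (rule pairing_eq_0[OF supported_schur low])
      fix a assume "polynomial_exp n a"
      then have "0 \<le> weight n a" by (intro weight_nonneg) (simp add: polynomial_exp_def)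
      then show "\<not> lower n (- 1) a" by (simp add: lower_def)
    qed (use len_\<nu> \<nu>_nonneg in simp_all)
    moreover have "(\<Sum>k\<le>N. K k) = pairing ?s (xpow \<gamma> * denom (levi n) + xpow \<gamma> * denom (levi n) * ?R)"
    proof -
      have "(\<Sum>k\<le>N. xpow \<gamma> * fps_nth (B_series \<eta>) k * block_denom 0 n) =
          xpow \<gamma> * denom (levi n) * (denom (Roots \<eta>) * (\<Sum>k\<le>N. fps_nth (B_series \<eta>) k))"
        unfolding denom_split sum_distrib_left by (intro sum.cong refl) (simp only: mult_ac)
      also have "\<dots> = xpow \<gamma> * denom (levi n) + xpow \<gamma> * denom (levi n) * ?R"
        by (simp only: right_diff_distrib mult_1_right add_diff_cancel_left' diff_add_cancel add_diff_eq)
      finally show ?thesis by (simp only: K_def K_coeff pairing_sum[symmetric])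
    qed
    ultimately show ?thesis by (simp add: pairing_add)
  qed
  \<comment> \<open>Consecutive partial sums agree from \<open>N\<close> on, so all later
    \<open>K k\<close> vanish; hence the polynomial described in \<open>K_poly\<close>
    exists.\<close>
  define N where "N = nat (weight n g)"
  have K_0: "K k = 0" if "N < k" for k
  proof -
    from \<open>N < k\<close> obtain M where M: "k = Suc M" "N \<le> M" by (cases k) auto
    then have "weight n g \<le> int M" by (simp add: N_def)
    then have "(\<Sum>i\<le>Suc M. K i) = (\<Sum>i\<le>M. K i)"
      using partial_sum[of M] partial_sum[of "Suc M"] by simp
    with M show ?thesis by simp
  qed
  define p where "p = (\<Sum>k\<le>N. monom (K k) k)"
  have "coeff p k = K k" for k
    using K_0[of k] by (auto simp: p_def coeff_sum)
  then have "K_poly \<eta> \<gamma> \<nu> = p"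
    unfolding K_poly_def sum_\<eta> K_def[symmetric]
    by (intro the_equality) (auto intro: poly_eqI)
  then have "poly (K_poly \<eta> \<gamma> \<nu>) 1 = (\<Sum>k\<le>N. K k)"
    by (simp add: p_def poly_sum poly_monom)
  then show ?thesis by (simp add: partial_sum N_def)
qed

text \<open>Every pair joining an earlier block to block \<open>t\<close> is a root, and no pair
  inside block \<open>t\<close> is one.\<close>

lemma levi_Suc:
  assumes "t < length \<eta>"
  shows "levi (sum_list (take (Suc t) \<eta>)) = levi (sum_list (take t \<eta>)) \<union>
    {(i, j). sum_list (take t \<eta>) \<le> i \<and> i < j \<and> j < sum_list (take t \<eta>) + \<eta> ! t}"
    (is "?L = ?M \<union> ?N")
proof -
  let ?P = "\<lambda>r. sum_list (take r \<eta>)"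
  have P_Suc: "?P (Suc t) = ?P t + \<eta> ! t"
    using assms by (simp add: take_Suc_conv_app_nth)
  have same_block: "(i, j) \<notin> Roots \<eta>" if "?P t \<le> i" "j < ?P (Suc t)" for i j
  proof
    assume "(i, j) \<in> Roots \<eta>"
    then obtain r where r: "i < ?P r" "?P r \<le> j" by (auto simp: Roots_def)
    show False
    proof (cases "r \<le> t")
      case True
      with r that sum_list_take_mono[of r t \<eta>] show False by simp
    next
      case False
      with r that sum_list_take_mono[of "Suc t" r \<eta>] show False by simp
    qed
  qed
  have other_block: "(i, j) \<in> Roots \<eta>" if "i < ?P t" "?P t \<le> j" "j < ?P (Suc t)" for i j
  proof -
    \<comment> \<open>\<open>Roots\<close> requires a boundary index of at least 1; for
      \<open>t = 0\<close> there is no \<open>i\<close> below the boundary.\<close>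
    have "t \<noteq> 0" using that by (intro notI) simp
    moreover have "j < sum_list \<eta>" using that sum_list_take_le[of "Suc t" \<eta>] by simp
    ultimately show ?thesis using that assms by (auto simp: Roots_def intro!: bexI[of _ t])
  qed
  have "(i, j) \<in> ?L \<longleftrightarrow> (i, j) \<in> ?M \<union> ?N" for i j
    using same_block[of i j] other_block[of i j] unfolding levi_def P_Suc
    by (cases "j < ?P t"; cases "?P t \<le> i") auto
  then show ?thesis by auto
qed

text \<open>By induction over the blocks: the argument splits into a factor in the variables before
  block \<open>t\<close> and a factor in those of block \<open>t\<close>. Across them
  \<open>hom_map\<close> is multiplicative, and the second factor yields the Jacobi--Trudi
  determinant of the block.\<close>

lemma prod_schur_blocks:
  assumes nonneg: "\<And>i. i < length \<eta> \<Longrightarrow> \<forall>a\<in>set (block \<eta> \<gamma> i). 0 \<le> a" and "t \<le> length \<eta>"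
  shows "(\<Prod>i<t. schur n (block \<eta> \<gamma> i)) =
    hom_map n (monomial (expo 0 (sum_list (take t \<eta>)) (\<lambda>i. \<gamma> ! i)) * denom (levi (sum_list (take t \<eta>))))"
  using assms(2)
proof (induction t)
  case 0
  then show ?case
    by (simp add: levi_def denom_def expo_def hom_map_monomial)
next
  case (Suc t)
  define p where "p = sum_list (take t \<eta>)"
  define m where "m = \<eta> ! t"
  have t: "t < length \<eta>" using Suc by simp
  have p_m: "sum_list (take (Suc t) \<eta>) = p + m"
    using t by (simp add: take_Suc_conv_app_nth p_def m_def)
  have le: "p + m \<le> n"
    using sum_list_take_le[of "Suc t" \<eta>] by (simp add: p_m sum_\<eta>)
  let ?N = "{(i, j). p \<le> i \<and> i < j \<and> j < p + m}"
  have block: "schur n (block \<eta> \<gamma> t) = hom_det n m (\<lambda>i. \<gamma> ! (p + i))"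
  proof -
    have len: "length (block \<eta> \<gamma> t) = m"
      using le len_\<gamma> by (simp add: block_def p_def m_def)
    then have "schur n (block \<eta> \<gamma> t) = hom_det n m (\<lambda>i. block \<eta> \<gamma> t ! i)"
      using le nonneg[OF t] by (subst schur_eq_hom_det) simp_all
    also have "\<dots> = hom_det n m (\<lambda>i. \<gamma> ! (p + i))"
      using le len_\<gamma> by (intro hom_det_cong) (simp add: block_def p_def m_def)
    finally show ?thesis .
  qed
  have "finite (levi p)"
    by (rule finite_subset[of _ "{..<p} \<times> {..<p}"]) (auto simp: levi_def)
  moreover have "finite ?N"
    by (rule finite_subset[of _ "{..<p + m} \<times> {..<p + m}"]) auto
  moreover have levi_eq: "levi (p + m) = levi p \<union> ?N"
    using levi_Suc[OF t] by (simp only: p_m p_def[symmetric] m_def[symmetric])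
  ultimately have denom_eq: "denom (levi (p + m)) = denom (levi p) * block_denom p m"
    unfolding levi_eq block_denom_eq denom_def
    by (intro prod.union_disjoint) (auto simp: levi_def)
  have expo_eq: "expo 0 (p + m) (\<lambda>i. \<gamma> ! i) = expo 0 p (\<lambda>i. \<gamma> ! i) + expo p m (\<lambda>i. \<gamma> ! (p + i))"
    by (rule poly_mapping_eqI) (auto simp: lookup_expo lookup_add)
  have split: "monomial (expo 0 (p + m) (\<lambda>i. \<gamma> ! i)) * denom (levi (p + m)) =
      (monomial (expo 0 p (\<lambda>i. \<gamma> ! i)) * denom (levi p)) *
      (monomial (expo p m (\<lambda>i. \<gamma> ! (p + i))) * block_denom p m)"
    unfolding denom_eq expo_eq monomial_add by (simp only: mult_ac)
  have left: "in_vars p (monomial (expo 0 p (\<lambda>i. \<gamma> ! i)) * denom (levi p))"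
    using keys_expo[of 0 p "\<lambda>i. \<gamma> ! i"]
    by (intro in_vars_mult supported_lower_in_vars[OF supported_lower_denom])
      (auto simp: levi_def atLeast0LessThan)
  have right: "supported (\<lambda>a. keys a \<subseteq> {p..}) (monomial (expo p m (\<lambda>i. \<gamma> ! (p + i))) * block_denom p m)"
    unfolding block_denom_eq
  proof (rule supported_mult[OF _ supported_denom_ge[of _ p]])
    show "supported (\<lambda>a. keys a \<subseteq> {p..}) (monomial (expo p m (\<lambda>i. \<gamma> ! (p + i))))"
      using keys_expo[of p m "\<lambda>i. \<gamma> ! (p + i)"] by auto
  qed (auto simp: keys_add_subset)
  have "(\<Prod>i<t. schur n (block \<eta> \<gamma> i)) =
      hom_map n (monomial (expo 0 p (\<lambda>i. \<gamma> ! i)) * denom (levi p))"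
    unfolding p_def using Suc by (intro Suc.IH) simp
  then show ?case
    unfolding prod.lessThan_Suc p_m split hom_map_mult[OF left right]
    by (simp only: hom_map_block[OF le] block)
qed

text \<open>The inner product with \<open>schur n \<nu>\<close> is a Schur coefficient of
  \<open>hom_map n (xpow \<gamma> * denom (levi n))\<close>, which adjointness evaluates as the
  pairing.\<close>

lemma hall_inner_blocks:
  assumes "\<And>i. i < length \<eta> \<Longrightarrow> \<forall>a\<in>set (block \<eta> \<gamma> i). 0 \<le> a"
  shows "hall_inner n (schur n \<nu>) (\<Prod>i<length \<eta>. schur n (block \<eta> \<gamma> i)) =
    pairing (schur n \<nu>) (xpow \<gamma> * denom (levi n))"
proof -
  let ?f = "xpow \<gamma> * denom (levi n)"
  have "expo 0 n (\<lambda>i. \<gamma> ! i) = Poly_Mapping.nth \<gamma>"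
    using keys_nth_subset[of \<gamma> n] len_\<gamma>
    by (intro expo_eqI[symmetric]) (simp_all add: lookup_nth_list del: lookup_nth keys_nth)
  then have prod: "(\<Prod>i<length \<eta>. schur n (block \<eta> \<gamma> i)) = hom_map n ?f"
    using prod_schur_blocks[OF assms, of "length \<eta>"] by (simp add: sum_\<eta> xpow_def)
  have "in_vars n ?f"
    by (intro in_vars_mult in_vars_xpow supported_lower_in_vars[OF supported_lower_denom])
      (auto simp: levi_def)
  then have "adjoint n ?f" by (rule adjoint_in_vars)
  then obtain F where F: "in_vars n F"
    "antisymmetrize n (xpow (rho n)) * hom_map n ?f = antisymmetrize n F"
    and pairing: "\<forall>\<nu>. length \<nu> = n \<longrightarrow> (\<forall>a\<in>set \<nu>. 0 \<le> a) \<longrightarrow>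
      lookup (antisymmetrize n F) (Poly_Mapping.nth \<nu> + rho_exp n) = pairing (schur n \<nu>) ?f"
    unfolding adjoint_def by blast
  show ?thesis
    unfolding prod hall_inner_schur[OF \<nu>_dominant] schur_expansion_props(2)[OF F \<nu>_dominant]
    using pairing len_\<nu> \<nu>_nonneg by blast
qed

end

theorem proposition7:
  fixes \<eta> :: "nat list" and n :: nat and \<gamma> lam :: "int list"
  assumes "\<forall>m\<in>set \<eta>. 0 < m"
    and "sum_list \<eta> = n"
    and "length \<gamma> = n"
    and "\<forall>i<length \<eta>. is_partition (block \<eta> \<gamma> i)"
    and "length lam = n"
    and "is_partition lam"
    and "sum_list lam = (\<Sum>i<length \<eta>. sum_list (block \<eta> \<gamma> i))"
  shows "poly (K_poly \<eta> \<gamma> lam) 1 =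
    hall_inner n (schur n lam) (\<Prod>i<length \<eta>. schur n (block \<eta> \<gamma> i))"
  using assms
  by (simp add: K_poly_at_1[of \<eta> n \<gamma> lam] hall_inner_blocks[of \<eta> n \<gamma> lam] is_partition_def)

end
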